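(* Consider the time-invariant mean-field system $$x_{k+1}=(Ax_k+\bar AEx_k+Bu_k+\bar BEu_k)+(Cx_k+\bar CEx_k+Du_k+\bar DEu_k)w_k,\quad x_0=\xi,$$ and the cost $$J=\sum_{k=0}^\infty E[x_k'Qx_k+(Ex_k)'\bar QEx_k+u_k'Ru_k+(Eu_k)'\bar REu_k].$$ Assume $R>0$, $R+\bar R>0$, $Q\ge0$, $Q+\bar Q\ge0$, and that $(A,\bar A,C,\bar C,\mathcal Q^{1/2})$ is exactly observable. Then the system is stabilizable in the mean square sense if and only if there exists a unique solution $P,\bar P$ to the coupled algebraic Riccati equation $$P=Q+A'PA+\sigma^2C'PC-[M^{(1)}]'[\Upsilon^{(1)}]^{-1}M^{(1)},$$ $$\begin{aligned}\bar P=\;&\bar Q+A'P\bar A+\sigma^2C'P\bar C+\bar A'PA+\sigma^2\bar C'PC+\bar A'P\bar A+\sigma^2\bar C'P\bar C\\&+(A+\bar A)'\bar P(A+\bar A)+[M^{(1)}]'[\Upsilon^{(1)}]^{-1}M^{(1)}-[M^{(2)}]'[\Upsilon^{(2)}]^{-1}M^{(2)}\end{aligned}$$ satisfying $P>0$ and $P+\bar P>0$, where $$\Upsilon^{(1)}=R+B'PB+\sigma^2D'PD,\qquad M^{(1)}=B'PA+\sigma^2D'PC,$$ $$\Upsilon^{(2)}=R+\bar R+(B+\bar B)'(P+\bar P)(B+\bar B)+\sigma^2(D+\bar D)'P(D+\bar D),$$ $$M^{(2)}=(B+\bar B)'(P+\bar P)(A+\bar A)+\sigma^2(D+\bar D)'P(C+\bar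 C).$$ In this case, a stabilizing controller is $$u_k=Kx_k+\bar KEx_k,\quad K=-[\Upsilon^{(1)}]^{-1}M^{(1)},\quad \bar K=-\{[\Upsilon^{(2)}]^{-1}M^{(2)}-[\Upsilon^{(1)}]^{-1}M^{(1)}\}.$$ Moreover, this controller minimizes the cost $J$ (among stabilizing controllers), and the optimal cost is $$J^*=E(x_0'Px_0)+(Ex_0)'\bar PEx_0.$$
   Context: $A,\bar A,C,\bar C\in\mathcal R^{n\times n}$ and $B,\bar B,D,\bar D\in\mathcal R^{n\times m}$ are constant; $Q,\bar Q,R,\bar R$ are constant symmetric matrices; $P,\bar P$ range over real symmetric matrices. A prime denotes transpose; $>0$ ($\ge0$) means positive (semi-)definite. $(w_k)_{k\ge0}$ is scalar white noise (independent, independent of $x_0$, zero mean, variance $\sigma^2$), and initial states are square-integrable random vectors. $\mathcal F_k$ is the augmented $\sigma$-algebra generated by $x_0,w_0,\dots,w_k$, and $\mathcal F_{-1}$ is the one generated by $x_0$. A random vector $x$ is called zero ($x=0$) if $E(x'x)=0$. Stability: the system with $u_k=0$ is asymptotically mean square stable if $\lim_{k\to\infty}E(x_k'x_k)=0$ for any initial value $x_0$. Stabilizability: the system is stabilizable in the mean square sense if there is an $\mathcal F_{k-1}$-measurable linear controller in terms of $x_k$ and $Ex_k$, $u_k=Lx_k+\bar LEx_k$ with constant matrices $L,\bar L$, such that for any random vector $x_0$ the closed loop is asymptotically mean square stable. The optimization problem is to find an $\mathcal F_{k-1}$-measurable linear controller in terms of $x_k$ and $Ex_k$ that minimizes $J$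 and stabilizes the system in the mean square sense. Exact observability: let $\mathcal Q=\begin{bmatrix}Q&0\\ 0&Q+\bar Q\end{bmatrix}$, $\mathbb X_k=\begin{bmatrix}x_k-Ex_k\\ E x_k\end{bmatrix}$, and consider $x_{k+1}=(Ax_k+\bar AEx_k)+(Cx_k+\bar CEx_k)w_k$, $Y_k=\mathcal Q^{1/2}\mathbb X_k$. This system, denoted $(A,\bar A,C,\bar C,\mathcal Q^{1/2})$, is exactly observable if for any $N\ge0$: $Y_k=0$ for all $0\le k\le N$ implies $x_0=0$. *)

theory Defs
  imports "HOL-Probability.Probability"
begin

section \<open>Symmetric matrices\<close>

definition pos_def :: "real^'n^'n \<Rightarrow> bool" where
  "pos_def S \<longleftrightarrow> transpose S = S \<and> (\<forall>x. x \<noteq> 0 \<longrightarrow> 0 < x \<bullet> (S *v x))"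

definition pos_semidef :: "real^'n^'n \<Rightarrow> bool" where
  "pos_semidef S \<longleftrightarrow> transpose S = S \<and> (\<forall>x. 0 \<le> x \<bullet> (S *v x))"

text \<open>A positive semidefinite matrix has exactly one positive semidefinite square root, so the
  choice is immaterial.\<close>

definition psd_sqrt :: "real^'n^'n \<Rightarrow> real^'n^'n" where
  "psd_sqrt S = (SOME T. pos_semidef T \<and> T ** T = S)"

definition block_diag :: "real^'n^'n \<Rightarrow> real^'m^'m \<Rightarrow> real^('n + 'm)^('n + 'm)" where
  "block_diag S T = (\<chi> i j. case (i, j) of
      (Inl k, Inl l) \<Rightarrow> S $ k $ l
    | (Inr k, Inr l) \<Rightarrow> T $ k $ l
    | _ \<Rightarrow> 0)"

definition stack :: "real^'n \<Rightarrow> real^'m \<Rightarrow> real^('n + 'm)" where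
  "stack x y = (\<chi> i. case i of Inl k \<Rightarrow> x $ k | Inr l \<Rightarrow> y $ l)"


section \<open>Noise, initial states, information\<close>

definition white_noise :: "'s measure \<Rightarrow> (nat \<Rightarrow> 's \<Rightarrow> real) \<Rightarrow> real \<Rightarrow> bool" where
  "white_noise M w \<sigma> \<longleftrightarrow>
     prob_space M \<and>
     (\<forall>k. w k \<in> borel_measurable M \<and> integrable M (\<lambda>\<omega>. (w k \<omega>)\<^sup>2)) \<and>
     prob_space.indep_vars M (\<lambda>_. borel) w UNIV \<and>
     (\<forall>k. prob_space.expectation M (w k) = 0 \<and> prob_space.variance M (w k) = \<sigma>\<^sup>2)"

text \<open>A square-integrable random vector \<open>x0\<close> such that \<open>x0, w 0, w 1, \<dots>\<close> are independent.
  Since \<^const>\<open>prob_space.indep_vars\<close> requires a common value type, independence is expressed by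
  the generated \<open>\<sigma>\<close>-algebras.\<close>

definition initial_state :: "'s measure \<Rightarrow> (nat \<Rightarrow> 's \<Rightarrow> real) \<Rightarrow> ('s \<Rightarrow> real^'n) \<Rightarrow> bool" where
  "initial_state M w x0 \<longleftrightarrow>
     x0 \<in> borel_measurable M \<and>
     integrable M (\<lambda>\<omega>. x0 \<omega> \<bullet> x0 \<omega>) \<and>
     prob_space.indep_sets M
       (\<lambda>i. case i of
              None \<Rightarrow> sets (vimage_algebra (space M) x0 borel)
            | Some k \<Rightarrow> sets (vimage_algebra (space M) (w k) borel)) UNIV"

text \<open>The augmented \<open>\<sigma>\<close>-algebra \<open>\<F>\<close> with index \<open>k - 1\<close>: generated by \<open>x0\<close>, by the noise before
  time \<open>k\<close>, and by the null sets.\<close>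

definition information :: "'s measure \<Rightarrow> (nat \<Rightarrow> 's \<Rightarrow> real) \<Rightarrow> ('s \<Rightarrow> real^'n) \<Rightarrow> nat \<Rightarrow> 's measure" where
  "information M w x0 k = sigma (space M)
     (sets (vimage_algebra (space M) x0 borel) \<union>
      (\<Union>i<k. sets (vimage_algebra (space M) (w i) borel)) \<union>
      null_sets M)"

definition zero_vec :: "'s measure \<Rightarrow> ('s \<Rightarrow> real^'n) \<Rightarrow> bool" where
  "zero_vec M x \<longleftrightarrow> prob_space.expectation M (\<lambda>\<omega>. x \<omega> \<bullet> x \<omega>) = 0"


section \<open>The controlled system\<close>

definition feedback ::
  "'s measure \<Rightarrow> real^'n^'m \<Rightarrow> real^'n^'m \<Rightarrow> ('s \<Rightarrow> real^'n) \<Rightarrow> 's \<Rightarrow> real^'m" where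
  "feedback M L Lb x = (\<lambda>\<omega>. L *v x \<omega> + Lb *v prob_space.expectation M x)"

definition mf_step ::
  "'s measure \<Rightarrow> real^'n^'n \<Rightarrow> real^'n^'n \<Rightarrow> real^'m^'n \<Rightarrow> real^'m^'n \<Rightarrow>
   real^'n^'n \<Rightarrow> real^'n^'n \<Rightarrow> real^'m^'n \<Rightarrow> real^'m^'n \<Rightarrow>
   ('s \<Rightarrow> real) \<Rightarrow> ('s \<Rightarrow> real^'n) \<Rightarrow> ('s \<Rightarrow> real^'m) \<Rightarrow> 's \<Rightarrow> real^'n" where
  "mf_step M A Ab B Bb C Cb D Db wk x u = (\<lambda>\<omega>.
     (A *v x \<omega> + Ab *v prob_space.expectation M x +
      B *v u \<omega> + Bb *v prob_space.expectation M u) +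
     wk \<omega> *\<^sub>R
     (C *v x \<omega> + Cb *v prob_space.expectation M x +
      D *v u \<omega> + Db *v prob_space.expectation M u))"

text \<open>The state under the linear controller with gains \<open>L k\<close> and \<open>Lb k\<close> at time \<open>k\<close>.\<close>

primrec closed_loop ::
  "'s measure \<Rightarrow> (nat \<Rightarrow> 's \<Rightarrow> real) \<Rightarrow>
   real^'n^'n \<Rightarrow> real^'n^'n \<Rightarrow> real^'m^'n \<Rightarrow> real^'m^'n \<Rightarrow>
   real^'n^'n \<Rightarrow> real^'n^'n \<Rightarrow> real^'m^'n \<Rightarrow> real^'m^'n \<Rightarrow>
   (nat \<Rightarrow> real^'n^'m) \<Rightarrow> (nat \<Rightarrow> real^'n^'m) \<Rightarrow>
   ('s \<Rightarrow> real^'n) \<Rightarrow> nat \<Rightarrow> 's \<Rightarrow> real^'n" where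
  "closed_loop M w A Ab B Bb C Cb D Db L Lb x0 0 = x0"
| "closed_loop M w A Ab B Bb C Cb D Db L Lb x0 (Suc k) =
     mf_step M A Ab B Bb C Cb D Db (w k)
       (closed_loop M w A Ab B Bb C Cb D Db L Lb x0 k)
       (feedback M (L k) (Lb k) (closed_loop M w A Ab B Bb C Cb D Db L Lb x0 k))"

definition control ::
  "'s measure \<Rightarrow> (nat \<Rightarrow> 's \<Rightarrow> real) \<Rightarrow>
   real^'n^'n \<Rightarrow> real^'n^'n \<Rightarrow> real^'m^'n \<Rightarrow> real^'m^'n \<Rightarrow>
   real^'n^'n \<Rightarrow> real^'n^'n \<Rightarrow> real^'m^'n \<Rightarrow> real^'m^'n \<Rightarrow>
   (nat \<Rightarrow> real^'n^'m) \<Rightarrow> (nat \<Rightarrow> real^'n^'m) \<Rightarrow>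
   ('s \<Rightarrow> real^'n) \<Rightarrow> nat \<Rightarrow> 's \<Rightarrow> real^'m" where
  "control M w A Ab B Bb C Cb D Db L Lb x0 k =
     feedback M (L k) (Lb k) (closed_loop M w A Ab B Bb C Cb D Db L Lb x0 k)"

definition ms_stable :: "'s measure \<Rightarrow> (nat \<Rightarrow> 's \<Rightarrow> real^'n) \<Rightarrow> bool" where
  "ms_stable M x \<longleftrightarrow> (\<lambda>k. prob_space.expectation M (\<lambda>\<omega>. x k \<omega> \<bullet> x k \<omega>)) \<longlonglongrightarrow> 0"

definition stabilizing ::
  "'s measure \<Rightarrow> (nat \<Rightarrow> 's \<Rightarrow> real) \<Rightarrow>
   real^'n^'n \<Rightarrow> real^'n^'n \<Rightarrow> real^'m^'n \<Rightarrow> real^'m^'n \<Rightarrow>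
   real^'n^'n \<Rightarrow> real^'n^'n \<Rightarrow> real^'m^'n \<Rightarrow> real^'m^'n \<Rightarrow>
   (nat \<Rightarrow> real^'n^'m) \<Rightarrow> (nat \<Rightarrow> real^'n^'m) \<Rightarrow> bool" where
  "stabilizing M w A Ab B Bb C Cb D Db L Lb \<longleftrightarrow>
     (\<forall>x0. initial_state M w x0 \<longrightarrow>
        (\<forall>k. control M w A Ab B Bb C Cb D Db L Lb x0 k
               \<in> borel_measurable (information M w x0 k)) \<and>
        ms_stable M (closed_loop M w A Ab B Bb C Cb D Db L Lb x0))"

definition stabilizable ::
  "'s measure \<Rightarrow> (nat \<Rightarrow> 's \<Rightarrow> real) \<Rightarrow>
   real^'n^'n \<Rightarrow> real^'n^'n \<Rightarrow> real^'m^'n \<Rightarrow> real^'m^'n \<Rightarrow>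
   real^'n^'n \<Rightarrow> real^'n^'n \<Rightarrow> real^'m^'n \<Rightarrow> real^'m^'n \<Rightarrow> bool" where
  "stabilizable M w A Ab B Bb C Cb D Db \<longleftrightarrow>
     (\<exists>L Lb. stabilizing M w A Ab B Bb C Cb D Db (\<lambda>_. L) (\<lambda>_. Lb))"

text \<open>The cost is extended-real valued because a stabilizing time-varying controller may have
  infinite cost. For \<open>Q, Q + Qb, R, R + Rb \<ge> 0\<close> all summands are nonnegative.\<close>

definition cost ::
  "'s measure \<Rightarrow> (nat \<Rightarrow> 's \<Rightarrow> real) \<Rightarrow>
   real^'n^'n \<Rightarrow> real^'n^'n \<Rightarrow> real^'m^'n \<Rightarrow> real^'m^'n \<Rightarrow>
   real^'n^'n \<Rightarrow> real^'n^'n \<Rightarrow> real^'m^'n \<Rightarrow> real^'m^'n \<Rightarrow>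
   real^'n^'n \<Rightarrow> real^'n^'n \<Rightarrow> real^'m^'m \<Rightarrow> real^'m^'m \<Rightarrow>
   (nat \<Rightarrow> real^'n^'m) \<Rightarrow> (nat \<Rightarrow> real^'n^'m) \<Rightarrow> ('s \<Rightarrow> real^'n) \<Rightarrow> ereal" where
  "cost M w A Ab B Bb C Cb D Db Q Qb R Rb L Lb x0 =
     (\<Sum>k. let x = closed_loop M w A Ab B Bb C Cb D Db L Lb x0 k;
                u = control M w A Ab B Bb C Cb D Db L Lb x0 k;
                Ex = prob_space.expectation M x;
                Eu = prob_space.expectation M u
            in ereal (prob_space.expectation M (\<lambda>\<omega>.
                 x \<omega> \<bullet> (Q *v x \<omega>) + Ex \<bullet> (Qb *v Ex) +
                 u \<omega> \<bullet> (R *v u \<omega>) + Eu \<bullet> (Rb *v Eu))))"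


section \<open>Exact observability\<close>

primrec uncontrolled ::
  "'s measure \<Rightarrow> (nat \<Rightarrow> 's \<Rightarrow> real) \<Rightarrow>
   real^'n^'n \<Rightarrow> real^'n^'n \<Rightarrow> real^'n^'n \<Rightarrow> real^'n^'n \<Rightarrow>
   ('s \<Rightarrow> real^'n) \<Rightarrow> nat \<Rightarrow> 's \<Rightarrow> real^'n" where
  "uncontrolled M w A Ab C Cb x0 0 = x0"
| "uncontrolled M w A Ab C Cb x0 (Suc k) = (\<lambda>\<omega>.
     (let x = uncontrolled M w A Ab C Cb x0 k; Ex = prob_space.expectation M x
      in (A *v x \<omega> + Ab *v Ex) + w k \<omega> *\<^sub>R (C *v x \<omega> + Cb *v Ex)))"

definition observed ::
  "'s measure \<Rightarrow> (nat \<Rightarrow> 's \<Rightarrow> real) \<Rightarrow>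
   real^'n^'n \<Rightarrow> real^'n^'n \<Rightarrow> real^'n^'n \<Rightarrow> real^'n^'n \<Rightarrow> real^('n + 'n)^('n + 'n) \<Rightarrow>
   ('s \<Rightarrow> real^'n) \<Rightarrow> nat \<Rightarrow> 's \<Rightarrow> real^('n + 'n)" where
  "observed M w A Ab C Cb G x0 k = (\<lambda>\<omega>.
     (let x = uncontrolled M w A Ab C Cb x0 k; Ex = prob_space.expectation M x
      in G *v stack (x \<omega> - Ex) Ex))"

text \<open>The horizon \<open>N\<close> is quantified inside the premise: an initial state whose output vanishes on
  every finite horizon is zero. With \<open>N\<close> quantified outside the implication, the instance
  \<open>N = 0\<close> alone would, for \<open>G\<close> the square root of \<open>block_diag Q (Q + Qb)\<close>, force \<open>Q\<close> and
  \<open>Q + Qb\<close> to be positive definite. The present condition is weaker, so results assuming it also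
  hold under that other reading.\<close>

definition exactly_observable ::
  "'s measure \<Rightarrow> (nat \<Rightarrow> 's \<Rightarrow> real) \<Rightarrow>
   real^'n^'n \<Rightarrow> real^'n^'n \<Rightarrow> real^'n^'n \<Rightarrow> real^'n^'n \<Rightarrow>
   real^('n + 'n)^('n + 'n) \<Rightarrow> bool" where
  "exactly_observable M w A Ab C Cb G \<longleftrightarrow>
     (\<forall>x0. initial_state M w x0 \<longrightarrow>
        (\<forall>N. \<forall>k\<le>N. zero_vec M (observed M w A Ab C Cb G x0 k)) \<longrightarrow> zero_vec M x0)"


section \<open>The coupled algebraic Riccati equation\<close>

definition Upsilon1 ::
  "real^'m^'n \<Rightarrow> real^'m^'n \<Rightarrow> real^'m^'m \<Rightarrow> real \<Rightarrow> real^'n^'n \<Rightarrow> real^'m^'m" where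
  "Upsilon1 B D R \<sigma> P =
     R + transpose B ** P ** B + \<sigma>\<^sup>2 *\<^sub>R (transpose D ** P ** D)"

definition M1 ::
  "real^'n^'n \<Rightarrow> real^'m^'n \<Rightarrow> real^'n^'n \<Rightarrow> real^'m^'n \<Rightarrow> real \<Rightarrow> real^'n^'n \<Rightarrow> real^'n^'m" where
  "M1 A B C D \<sigma> P =
     transpose B ** P ** A + \<sigma>\<^sup>2 *\<^sub>R (transpose D ** P ** C)"

definition Upsilon2 ::
  "real^'m^'n \<Rightarrow> real^'m^'n \<Rightarrow> real^'m^'n \<Rightarrow> real^'m^'n \<Rightarrow> real^'m^'m \<Rightarrow> real^'m^'m \<Rightarrow>
   real \<Rightarrow> real^'n^'n \<Rightarrow> real^'n^'n \<Rightarrow> real^'m^'m" where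
  "Upsilon2 B Bb D Db R Rb \<sigma> P Pb =
     R + Rb + transpose (B + Bb) ** (P + Pb) ** (B + Bb) +
     \<sigma>\<^sup>2 *\<^sub>R (transpose (D + Db) ** P ** (D + Db))"

definition M2 ::
  "real^'n^'n \<Rightarrow> real^'n^'n \<Rightarrow> real^'m^'n \<Rightarrow> real^'m^'n \<Rightarrow>
   real^'n^'n \<Rightarrow> real^'n^'n \<Rightarrow> real^'m^'n \<Rightarrow> real^'m^'n \<Rightarrow>
   real \<Rightarrow> real^'n^'n \<Rightarrow> real^'n^'n \<Rightarrow> real^'n^'m" where
  "M2 A Ab B Bb C Cb D Db \<sigma> P Pb =
     transpose (B + Bb) ** (P + Pb) ** (A + Ab) +
     \<sigma>\<^sup>2 *\<^sub>R (transpose (D + Db) ** P ** (C + Cb))"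

definition riccati ::
  "real^'n^'n \<Rightarrow> real^'n^'n \<Rightarrow> real^'m^'n \<Rightarrow> real^'m^'n \<Rightarrow>
   real^'n^'n \<Rightarrow> real^'n^'n \<Rightarrow> real^'m^'n \<Rightarrow> real^'m^'n \<Rightarrow>
   real^'n^'n \<Rightarrow> real^'n^'n \<Rightarrow> real^'m^'m \<Rightarrow> real^'m^'m \<Rightarrow>
   real \<Rightarrow> real^'n^'n \<Rightarrow> real^'n^'n \<Rightarrow> bool" where
  "riccati A Ab B Bb C Cb D Db Q Qb R Rb \<sigma> P Pb \<longleftrightarrow>
     (let U1 = Upsilon1 B D R \<sigma> P;
          N1 = M1 A B C D \<sigma> P;
          U2 = Upsilon2 B Bb D Db R Rb \<sigma> P Pb;
          N2 = M2 A Ab B Bb C Cb D Db \<sigma> P Pb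
      in P = Q + transpose A ** P ** A + \<sigma>\<^sup>2 *\<^sub>R (transpose C ** P ** C)
             - transpose N1 ** matrix_inv U1 ** N1 \<and>
         Pb = Qb + transpose A ** P ** Ab + \<sigma>\<^sup>2 *\<^sub>R (transpose C ** P ** Cb)
             + transpose Ab ** P ** A + \<sigma>\<^sup>2 *\<^sub>R (transpose Cb ** P ** C)
             + transpose Ab ** P ** Ab + \<sigma>\<^sup>2 *\<^sub>R (transpose Cb ** P ** Cb)
             + transpose (A + Ab) ** Pb ** (A + Ab)
             + transpose N1 ** matrix_inv U1 ** N1
             - transpose N2 ** matrix_inv U2 ** N2)"

definition riccati_solution ::
  "real^'n^'n \<Rightarrow> real^'n^'n \<Rightarrow> real^'m^'n \<Rightarrow> real^'m^'n \<Rightarrow>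
   real^'n^'n \<Rightarrow> real^'n^'n \<Rightarrow> real^'m^'n \<Rightarrow> real^'m^'n \<Rightarrow>
   real^'n^'n \<Rightarrow> real^'n^'n \<Rightarrow> real^'m^'m \<Rightarrow> real^'m^'m \<Rightarrow>
   real \<Rightarrow> (real^'n^'n) \<times> (real^'n^'n) \<Rightarrow> bool" where
  "riccati_solution A Ab B Bb C Cb D Db Q Qb R Rb \<sigma> = (\<lambda>(P, Pb).
     transpose P = P \<and> transpose Pb = Pb \<and>
     riccati A Ab B Bb C Cb D Db Q Qb R Rb \<sigma> P Pb \<and>
     pos_def P \<and> pos_def (P + Pb))"

definition gain_K ::
  "real^'n^'n \<Rightarrow> real^'m^'n \<Rightarrow> real^'n^'n \<Rightarrow> real^'m^'n \<Rightarrow> real^'m^'m \<Rightarrow>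
   real \<Rightarrow> real^'n^'n \<Rightarrow> real^'n^'m" where
  "gain_K A B C D R \<sigma> P = - (matrix_inv (Upsilon1 B D R \<sigma> P) ** M1 A B C D \<sigma> P)"

definition gain_Kb ::
  "real^'n^'n \<Rightarrow> real^'n^'n \<Rightarrow> real^'m^'n \<Rightarrow> real^'m^'n \<Rightarrow>
   real^'n^'n \<Rightarrow> real^'n^'n \<Rightarrow> real^'m^'n \<Rightarrow> real^'m^'n \<Rightarrow>
   real^'m^'m \<Rightarrow> real^'m^'m \<Rightarrow> real \<Rightarrow> real^'n^'n \<Rightarrow> real^'n^'n \<Rightarrow> real^'n^'m" where
  "gain_Kb A Ab B Bb C Cb D Db R Rb \<sigma> P Pb =
     - (matrix_inv (Upsilon2 B Bb D Db R Rb \<sigma> P Pb) ** M2 A Ab B Bb C Cb D Db \<sigma> P Pb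
        - matrix_inv (Upsilon1 B D R \<sigma> P) ** M1 A B C D \<sigma> P)"

end

(*
  Split the state into its mean m and its fluctuation y, and measure it by
  val (P, S) x = E(y'Py) + m'Sm. One closed-loop step turns val X into val (T X) for a positive
  linear operator T on pairs of symmetric matrices, so stability means that the iterates of T at
  (I, I) tend to 0. With S = P + Pb the two Riccati equations become one fixed-point equation
  X = Ric X, where Ric X is the pointwise minimum over all gains of (stage cost) + T X by
  completion of squares.

  If some gain is stabilizing, the iteration X := Ric X from 0 is increasing and bounded by the
  cost of that gain, hence converges to a fixed point. Conversely, let X be a fixed point with
  optimal operator T and stage cost c. The sums of the T^k c are bounded by X, their limit W is
  positive definite by observability (zero cost forces zero control, so the closed loop is then
  the uncontrolled system), and T^k W is a tail of a convergent series; as (I, I) is bounded by a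
  multiple of W, the loop is stable. Telescoping gives optimality, and optimality gives uniqueness
  since random test states realise every pair of vectors.
*)
theory Submission
  imports Defs
begin

section \<open>Quadratic forms\<close>

text \<open>Quantifying over initial states says something about fluctuations only if some
  admissible state fluctuates: at an almost surely constant state \<open>val X\<close> reduces to
  the mean part of \<open>X\<close>. One rescaled coordinate of a genuinely random state suffices,
  since \<open>val\<close> sees only mean and covariance; this is the use of
  \<open>random_initial\<close>. Order on pairs always means order of their forms \<open>qp\<close>,
  and polarization leads back from forms to matrices. Stability is mere convergence, without a rate.
  For a positive operator one power with \<open>T^N (I, I) \<le> (I, I) / 2\<close> already bounds
  all orbit sums, and this replaces a spectral radius argument. In the converse direction the tail
  property belongs to the limit of the orbit sums and not to the fixed point \<open>X\<close>,
  because \<open>T^k X\<close> is not known in advance to vanish. Competing controllers may vary in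
  time and may have infinite cost, so optimality is proved on finite sums whose terminal value is
  removed by stability.\<close>

definition qf :: "real^'n^'n \<Rightarrow> real^'n \<Rightarrow> real" where
  "qf P x = x \<bullet> (P *v x)"

text \<open>The rule rewrites \<open>transpose A *v x\<close> to \<open>x v* A\<close> and would
  hide the adjoint pattern of \<open>inner_transpose_left\<close>.\<close>

declare transpose_matrix_vector [simp del]

lemma inner_transpose_left: "x \<bullet> (transpose F *v y) = (F *v x) \<bullet> (y :: real^'n)"
  by (metis dot_lmul_matrix inner_commute transpose_matrix_vector)

lemma transpose_add: "transpose (A + B) = transpose A + transpose (B :: real^'n^'m)"
  by (simp add: transpose_def vec_eq_iff)

lemma transpose_diff: "transpose (A - B) = transpose A - transpose (B :: real^'n^'m)"
  by (simp add: transpose_def vec_eq_iff)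

lemma transpose_0 [simp]: "transpose (0 :: real^'n^'m) = 0"
  by (simp add: transpose_def vec_eq_iff)

lemma scaleR_matrix_mult_left: "(c *\<^sub>R A) ** B = c *\<^sub>R (A ** (B :: real^'n^'m))"
  by (simp add: matrix_matrix_mult_def vec_eq_iff sum_distrib_left mult.assoc)

lemma scaleR_matrix_mult_right: "A ** (c *\<^sub>R B) = c *\<^sub>R (A ** (B :: real^'n^'m))"
  by (simp add: matrix_matrix_mult_def vec_eq_iff sum_distrib_left algebra_simps)

lemma matrix_add_rdistrib_mult: "(A + B) ** C = A ** C + B ** (C :: real^'n^'m)"
  by (simp add: matrix_matrix_mult_def vec_eq_iff sum.distrib algebra_simps)

lemma uminus_matrix_vector_mult: "(- A) *v x = - (A *v (x :: real^'n))"
  by (simp add: matrix_vector_mult_def vec_eq_iff sum_negf)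

lemma inner_congruence: "y \<bullet> ((transpose F ** P ** G) *v x) = (F *v y) \<bullet> (P *v (G *v (x :: real^'n)))"
  by (simp add: matrix_vector_mul_assoc[symmetric] inner_transpose_left)

lemma qf_congruence: "qf (transpose F ** P ** F) x = qf P (F *v x)"
  by (simp add: qf_def inner_congruence)

lemma qf_add: "qf (P + S) x = qf P x + qf S x"
  by (simp add: qf_def algebra_simps inner_add_right)

lemma qf_diff: "qf (P - S) x = qf P x - qf S x"
  by (simp add: qf_def algebra_simps inner_diff_right)

lemma qf_scaleR: "qf (c *\<^sub>R P) x = c * qf P x"
  by (simp add: qf_def scaleR_matrix_vector_assoc[symmetric])

lemma qf_zero_matrix [simp]: "qf 0 x = 0"
  by (simp add: qf_def)

lemma qf_zero_vec [simp]: "qf P 0 = 0"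
  by (simp add: qf_def)

lemma qf_mat_1 [simp]: "qf (mat 1) x = x \<bullet> x"
  by (simp add: qf_def)

lemma qf_scale_vec: "qf P (c *\<^sub>R x) = c\<^sup>2 * qf P x"
  by (simp add: qf_def matrix_vector_mult_scaleR power2_eq_square)

lemma inner_symmetric: "transpose P = P \<Longrightarrow> x \<bullet> (P *v y) = y \<bullet> (P *v (x :: real^'n))"
  by (metis inner_transpose_left inner_commute)

lemma qf_add_vec:
  "transpose P = P \<Longrightarrow> qf P (x + y) = qf P x + 2 * (y \<bullet> (P *v x)) + qf P y"
  using inner_symmetric[of P x y] by (simp add: qf_def algebra_simps inner_add_left inner_add_right)

text \<open>Together with \<open>matrix_entry\<close> it expresses each entry of a symmetric matrix
  by three values of its form; the passages from forms back to matrices rest on this.\<close>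

lemma polarization:
  "transpose P = P \<Longrightarrow> y \<bullet> (P *v x) = (qf P (x + y) - qf P x - qf P y) / 2"
  by (simp add: qf_add_vec)

lemma matrix_entry: "A $ i $ k = axis i 1 \<bullet> (A *v axis k (1::real))"
  by (simp add: matrix_vector_mult_basis inner_axis' column_def)

lemma pos_def_imp_semidef: "pos_def P \<Longrightarrow> pos_semidef P"
  unfolding pos_def_def pos_semidef_def by (metis inner_zero_left less_eq_real_def)

lemma pos_semidef_iff: "pos_semidef P \<longleftrightarrow> transpose P = P \<and> (\<forall>x. 0 \<le> qf P x)"
  by (simp add: pos_semidef_def qf_def)

lemma pos_def_iff: "pos_def P \<longleftrightarrow> transpose P = P \<and> (\<forall>x. x \<noteq> 0 \<longrightarrow> 0 < qf P x)"
  by (simp add: pos_def_def qf_def)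

lemma pos_def_iff_semidef: "pos_def P \<longleftrightarrow> pos_semidef P \<and> (\<forall>x. qf P x = 0 \<longrightarrow> x = 0)"
  unfolding pos_def_iff pos_semidef_iff by (metis less_eq_real_def less_irrefl qf_zero_vec)

text \<open>The entrywise 1-norm: crude, but it dominates the operator norm and visibly tends to 0
  with the entries.\<close>

definition mbound :: "real^'n^'m \<Rightarrow> real" where
  "mbound A = (\<Sum>i\<in>UNIV. \<Sum>j\<in>UNIV. \<bar>A $ i $ j\<bar>)"

lemma mbound_nonneg: "0 \<le> mbound A"
  by (simp add: mbound_def sum_nonneg)

lemma norm_mult_le_mbound: "norm (A *v x) \<le> mbound A * norm x"
proof -
  have "norm (A *v x) \<le> onorm ((*v) A) * norm x"
    by (simp add: onorm)
  also have "\<dots> \<le> mbound A * norm x"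
    unfolding mbound_def by (intro mult_right_mono onorm_le_matrix_component_sum) auto
  finally show ?thesis .
qed

lemma abs_qf_le: "\<bar>qf P x\<bar> \<le> mbound P * (x \<bullet> x)"
proof -
  have "\<bar>qf P x\<bar> \<le> norm x * norm (P *v x)"
    unfolding qf_def by (rule Cauchy_Schwarz_ineq2)
  also have "\<dots> \<le> norm x * (mbound P * norm x)"
    by (intro mult_left_mono norm_mult_le_mbound) auto
  finally show ?thesis
    by (simp add: dot_square_norm power2_eq_square mult_ac)
qed

lemma tendsto_mbound_0: "(f \<longlongrightarrow> 0) F \<Longrightarrow> ((\<lambda>j. mbound (f j)) \<longlongrightarrow> 0) F"
  unfolding mbound_def
  by (intro tendsto_null_sum tendsto_rabs_zero) (metis tendsto_vec_nth zero_index)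

lemma tendsto_matrixI:
  fixes f :: "'b \<Rightarrow> real^'n^'m"
  assumes "\<And>i j. ((\<lambda>x. f x $ i $ j) \<longlongrightarrow> A $ i $ j) F"
  shows "(f \<longlongrightarrow> A) F"
  using assms by (intro vec_tendstoI)

section \<open>Limits of matrices and of symmetric forms\<close>

lemma tendsto_matrix_mult [tendsto_intros]:
  fixes f :: "'b \<Rightarrow> real^'n^'m" and g :: "'b \<Rightarrow> real^'k^'n"
  assumes "(f \<longlongrightarrow> A) F" "(g \<longlongrightarrow> B) F"
  shows "((\<lambda>x. f x ** g x) \<longlongrightarrow> A ** B) F"
  by (intro tendsto_matrixI)
     (auto simp: matrix_matrix_mult_def intro!: tendsto_intros assms)

lemma tendsto_matrix_vector_mult [tendsto_intros]:
  fixes f :: "'b \<Rightarrow> real^'n^'m" and g :: "'b \<Rightarrow> real^'n"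
  assumes "(f \<longlongrightarrow> A) F" "(g \<longlongrightarrow> B) F"
  shows "((\<lambda>x. f x *v g x) \<longlongrightarrow> A *v B) F"
  by (intro vec_tendstoI) (auto simp: matrix_vector_mult_def intro!: tendsto_intros assms)

lemma tendsto_transpose [tendsto_intros]:
  fixes f :: "'b \<Rightarrow> real^'n^'m"
  assumes "(f \<longlongrightarrow> A) F"
  shows "((\<lambda>x. transpose (f x)) \<longlongrightarrow> transpose A) F"
  by (intro tendsto_matrixI) (auto simp: transpose_def intro!: tendsto_intros assms)

lemma tendsto_qf [tendsto_intros]:
  "(f \<longlongrightarrow> A) F \<Longrightarrow> (g \<longlongrightarrow> x) F \<Longrightarrow> ((\<lambda>j. qf (f j) (g j)) \<longlongrightarrow> qf A x) F"
  unfolding qf_def by (intro tendsto_intros)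

lemma tendsto_symmetricI:
  assumes "\<And>j. transpose (f j) = f j" "transpose A = A" "\<And>x. ((\<lambda>j. qf (f j) x) \<longlongrightarrow> qf A x) F"
  shows "(f \<longlongrightarrow> A) F"
  by (intro tendsto_matrixI)
     (auto simp: matrix_entry polarization assms(1,2) intro!: tendsto_intros assms(3))

lemma symmetric_limit:
  fixes f :: "nat \<Rightarrow> real^'n^'n"
  assumes "\<And>j. transpose (f j) = f j" "f \<longlonglongrightarrow> A"
  shows "transpose A = A"
proof -
  have "f \<longlonglongrightarrow> transpose A"
    using tendsto_transpose[OF assms(2)] by (simp only: assms(1))
  then show ?thesis
    using assms(2) by (rule LIMSEQ_unique)
qed

text \<open>Monotone convergence for forms: at each vector the values are a bounded increasing real
  sequence, and polarization turns their limits into limits of entries.\<close>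

lemma monotone_symmetric_limit:
  fixes f :: "nat \<Rightarrow> real^'n^'n"
  assumes sym: "\<And>j. transpose (f j) = f j"
    and mono: "\<And>j x. qf (f j) x \<le> qf (f (Suc j)) x"
    and bound: "\<And>j x. qf (f j) x \<le> b x"
  obtains A where "f \<longlonglongrightarrow> A" "transpose A = A" "\<And>j x. qf (f j) x \<le> qf A x"
proof -
  have inc: "incseq (\<lambda>j. qf (f j) x)" for x
    by (rule incseq_SucI) (rule mono)
  have conv: "convergent (\<lambda>j. qf (f j) x)" for x
    by (rule incseq_convergent[OF inc, of x "b x"]) (auto simp: convergent_def bound)
  then obtain l where l: "(\<lambda>j. qf (f j) x) \<longlonglongrightarrow> l x" for x
    unfolding convergent_def by metis
  \<comment> \<open>The entries that polarization at basis vectors forces on a limit with form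
    \<open>l\<close>.\<close>
  define A :: "real^'n^'n" where
    "A = (\<chi> i k. (l (axis k 1 + axis i 1) - l (axis k 1) - l (axis i 1)) / 2)"
  have lim: "f \<longlonglongrightarrow> A"
    by (rule tendsto_matrixI)
       (auto simp: A_def matrix_entry polarization sym intro!: tendsto_intros l)
  have "qf (f j) x \<le> qf A x" for j x
    using incseq_le[OF inc tendsto_qf[OF lim tendsto_const]] .
  with that lim symmetric_limit[OF sym lim] show ?thesis
    by blast
qed

section \<open>Inverses of positive definite matrices\<close>

lemma matrix_inv_mult:
  assumes "invertible (U :: real^'n^'n)"
  shows matrix_inv_right: "U ** matrix_inv U = mat 1"
    and matrix_inv_left: "matrix_inv U ** U = mat 1"
  using someI_ex[OF assms[unfolded invertible_def]] by (auto simp: matrix_inv_def)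

lemma invertible_pos_def:
  assumes "pos_def U" shows "invertible U"
proof -
  have "U *v x = 0 \<Longrightarrow> x = 0" for x
    using assms unfolding pos_def_def by (metis inner_zero_right less_irrefl)
  then show ?thesis
    using matrix_left_invertible_ker[of U] invertible_left_inverse[of U] by blast
qed

lemma transpose_matrix_inv:
  assumes "invertible U" "transpose U = U"
  shows "transpose (matrix_inv U) = (matrix_inv U :: real^'n^'n)"
proof -
  have "transpose (matrix_inv U) ** U = mat 1"
    using arg_cong[OF matrix_inv_right[OF assms(1)], of transpose]
    by (simp add: matrix_transpose_mul assms(2))
  then have "transpose (matrix_inv U) ** (U ** matrix_inv U) = matrix_inv U"
    by (simp add: matrix_mul_assoc)
  then show ?thesis
    by (simp add: matrix_inv_right[OF assms(1)])
qed

text \<open>With \<open>u\<close> the preimage of \<open>x\<close>, coercivity and Cauchy-Schwarz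
  give \<open>\<epsilon> * norm u ^ 2 \<le> u \<bullet> x \<le> norm u * norm x\<close>. The bound
  depends on \<open>U\<close> only through \<open>\<epsilon>\<close>, so it is uniform along
  sequences.\<close>

lemma norm_matrix_inv_le:
  assumes "invertible U" "0 < \<epsilon>" "\<And>v. \<epsilon> * (v \<bullet> v) \<le> qf U v"
  shows "norm (matrix_inv U *v x) \<le> norm x / \<epsilon>"
proof -
  define u where "u = matrix_inv U *v x"
  have "U *v u = x"
    by (simp add: u_def matrix_vector_mul_assoc matrix_inv_right assms(1))
  then have "\<epsilon> * (norm u * norm u) \<le> norm u * norm x"
    using assms(3)[of u] norm_cauchy_schwarz[of u x]
    by (simp add: qf_def dot_square_norm power2_eq_square)
  then have "norm u * (\<epsilon> * norm u - norm x) \<le> 0"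
    by (simp add: algebra_simps)
  then have "\<epsilon> * norm u \<le> norm x"
    by (metis diff_gt_0_iff_gt linorder_not_less mult_pos_pos mult_zero_right norm_ge_zero
        order_le_less zero_less_norm_iff)
  then show ?thesis
    using assms(2) by (simp add: u_def field_simps)
qed

text \<open>The resolvent identity \<open>F^-1 - U^-1 = U^-1 (U - F) F^-1\<close> for
  \<open>F = f j\<close>; the common \<open>\<epsilon>\<close> keeps the last factor
  bounded.\<close>

lemma tendsto_matrix_inv:
  fixes f :: "nat \<Rightarrow> real^'n^'n"
  assumes lim: "f \<longlonglongrightarrow> U" and inv: "\<And>j. invertible (f j)" "invertible U"
    and eps: "0 < \<epsilon>" "\<And>j v. \<epsilon> * (v \<bullet> v) \<le> qf (f j) v"
  shows "(\<lambda>j. matrix_inv (f j)) \<longlonglongrightarrow> matrix_inv U"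
proof -
  have vec: "(\<lambda>j. matrix_inv (f j) *v x) \<longlonglongrightarrow> matrix_inv U *v x" for x
  proof -
    have bnd: "norm (matrix_inv (f j) *v x - matrix_inv U *v x)
        \<le> mbound (matrix_inv U) * (mbound (U - f j) * (norm x / \<epsilon>))" for j
    proof -
      define u where "u = matrix_inv (f j) *v x"
      have "f j *v u = x"
        by (simp add: u_def matrix_vector_mul_assoc matrix_inv_right inv(1))
      then have "matrix_inv U *v ((U - f j) *v u) = u - matrix_inv U *v x"
        by (simp add: matrix_vector_mult_diff_rdistrib matrix_vector_mult_diff_distrib
            matrix_vector_mul_assoc matrix_inv_left inv(2))
      moreover have "norm (matrix_inv U *v ((U - f j) *v u))
          \<le> mbound (matrix_inv U) * (mbound (U - f j) * norm u)"
        by (rule order_trans[OF norm_mult_le_mbound])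
           (intro mult_left_mono norm_mult_le_mbound mbound_nonneg)
      moreover have "norm u \<le> norm x / \<epsilon>"
        unfolding u_def by (rule norm_matrix_inv_le[OF inv(1) eps])
      ultimately show ?thesis
        by (smt (verit) mbound_nonneg mult_left_mono u_def)
    qed
    have "(\<lambda>j. U - f j) \<longlonglongrightarrow> 0"
      using tendsto_diff[OF tendsto_const lim, of U] by simp
    then have "(\<lambda>j. mbound (matrix_inv U) * (mbound (U - f j) * (norm x / \<epsilon>))) \<longlonglongrightarrow> 0"
      by (intro tendsto_mult_right_zero tendsto_mult_left_zero tendsto_mbound_0)
    then have "(\<lambda>j. matrix_inv (f j) *v x - matrix_inv U *v x) \<longlonglongrightarrow> 0"
      by (rule Lim_null_comparison[rotated]) (intro always_eventually allI bnd)
    then show ?thesis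
      by (simp add: LIM_zero_iff)
  qed
  show ?thesis
    by (rule tendsto_matrixI) (auto simp: matrix_entry intro!: tendsto_intros vec)
qed

text \<open>\<open>\<epsilon>\<close> is the minimum of the form on the compact unit sphere;
  homogeneity extends the bound.\<close>

lemma pos_def_coercive:
  fixes P :: "real^'n^'n"
  assumes "pos_def P"
  obtains \<epsilon> where "0 < \<epsilon>" "\<And>x. \<epsilon> * (x \<bullet> x) \<le> qf P x"
proof -
  have cont: "continuous_on (sphere 0 1) (qf P)"
    unfolding continuous_on_def by (auto intro!: tendsto_intros)
  have "axis undefined 1 \<in> sphere (0 :: real^'n) 1"
    by (simp add: norm_axis_1)
  then obtain z where z: "z \<in> sphere 0 1" "\<And>y. y \<in> sphere 0 1 \<Longrightarrow> qf P z \<le> qf P y"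
    using continuous_attains_inf[OF compact_sphere _ cont] by blast
  have "z \<noteq> 0"
    using z(1) by auto
  then have "0 < qf P z"
    using assms by (simp add: pos_def_iff)
  moreover have "qf P z * (x \<bullet> x) \<le> qf P x" for x
  proof (cases "x = 0")
    case False
    have "qf P z \<le> qf P (inverse (norm x) *\<^sub>R x)"
      using False by (intro z(2)) simp
    also have "\<dots> = qf P x / (x \<bullet> x)"
      by (simp add: qf_scale_vec dot_square_norm power2_eq_square divide_inverse)
    finally show ?thesis
      using False by (simp add: field_simps)
  qed auto
  ultimately show ?thesis
    using that by blast
qed

section \<open>Completion of squares\<close>

text \<open>\<open>S\<close> weighs the drift and \<open>P\<close> the noise term. The fluctuation
  takes \<open>S = P\<close>, the mean takes \<open>P + Pb\<close> for \<open>S\<close>, so one set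
  of lemmas serves both Riccati equations.\<close>

definition ups ::
  "real^'m^'n \<Rightarrow> real^'m^'n \<Rightarrow> real^'m^'m \<Rightarrow> real \<Rightarrow> real^'n^'n \<Rightarrow> real^'n^'n \<Rightarrow> real^'m^'m" where
  "ups B D R \<sigma> S P = R + transpose B ** S ** B + \<sigma>\<^sup>2 *\<^sub>R (transpose D ** P ** D)"

definition cross ::
  "real^'n^'n \<Rightarrow> real^'m^'n \<Rightarrow> real^'n^'n \<Rightarrow> real^'m^'n \<Rightarrow> real \<Rightarrow> real^'n^'n \<Rightarrow> real^'n^'n \<Rightarrow> real^'n^'m" where
  "cross A B C D \<sigma> S P = transpose B ** S ** A + \<sigma>\<^sup>2 *\<^sub>R (transpose D ** P ** C)"

definition ric ::
  "real^'n^'n \<Rightarrow> real^'m^'n \<Rightarrow> real^'n^'n \<Rightarrow> real^'m^'n \<Rightarrow> real^'n^'n \<Rightarrow> real^'m^'m \<Rightarrow> real \<Rightarrow>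
   real^'n^'n \<Rightarrow> real^'n^'n \<Rightarrow> real^'n^'n" where
  "ric A B C D Q R \<sigma> S P =
     Q + transpose A ** S ** A + \<sigma>\<^sup>2 *\<^sub>R (transpose C ** P ** C)
       - transpose (cross A B C D \<sigma> S P) ** matrix_inv (ups B D R \<sigma> S P) ** cross A B C D \<sigma> S P"

definition gain ::
  "real^'n^'n \<Rightarrow> real^'m^'n \<Rightarrow> real^'n^'n \<Rightarrow> real^'m^'n \<Rightarrow> real^'m^'m \<Rightarrow> real \<Rightarrow>
   real^'n^'n \<Rightarrow> real^'n^'n \<Rightarrow> real^'n^'m" where
  "gain A B C D R \<sigma> S P = - (matrix_inv (ups B D R \<sigma> S P) ** cross A B C D \<sigma> S P)"

text \<open>The Bellman expression before minimization over \<open>u\<close>: running cost plus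
  expected value of the next state.\<close>

definition stage ::
  "real^'n^'n \<Rightarrow> real^'m^'n \<Rightarrow> real^'n^'n \<Rightarrow> real^'m^'n \<Rightarrow> real^'n^'n \<Rightarrow> real^'m^'m \<Rightarrow> real \<Rightarrow>
   real^'n^'n \<Rightarrow> real^'n^'n \<Rightarrow> real^'n \<Rightarrow> real^'m \<Rightarrow> real" where
  "stage A B C D Q R \<sigma> S P x u =
     qf Q x + qf R u + qf S (A *v x + B *v u) + \<sigma>\<^sup>2 * qf P (C *v x + D *v u)"

text \<open>The matrix of \<open>stage\<close> under \<open>u = L x\<close>; with zero cost matrices
  only the linear one-step operator remains.\<close>

definition lyap ::
  "real^'n^'n \<Rightarrow> real^'m^'n \<Rightarrow> real^'n^'n \<Rightarrow> real^'m^'n \<Rightarrow> real^'n^'n \<Rightarrow> real^'m^'m \<Rightarrow> real \<Rightarrow>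
   real^'n^'m \<Rightarrow> real^'n^'n \<Rightarrow> real^'n^'n \<Rightarrow> real^'n^'n" where
  "lyap A B C D Q R \<sigma> L S P =
     Q + transpose L ** R ** L + transpose (A + B ** L) ** S ** (A + B ** L)
       + \<sigma>\<^sup>2 *\<^sub>R (transpose (C + D ** L) ** P ** (C + D ** L))"

lemma symmetric_congruence: "transpose P = P \<Longrightarrow> transpose (transpose F ** P ** F) = transpose F ** P ** F"
  for P :: "real^'n^'n" and F :: "real^'m^'n"
  by (simp add: matrix_transpose_mul matrix_mul_assoc)

lemma qf_lyap: "qf (lyap A B C D Q R \<sigma> L S P) x = stage A B C D Q R \<sigma> S P x (L *v x)"
  by (simp add: lyap_def stage_def qf_add qf_scaleR qf_congruence
      matrix_vector_mult_add_rdistrib matrix_vector_mul_assoc)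

lemma symmetric_lyap:
  assumes "transpose Q = Q" "transpose R = R" "transpose S = S" "transpose P = P"
  shows "transpose (lyap A B C D Q R \<sigma> L S P) = lyap A B C D Q R \<sigma> L S P"
proof -
  define F G where "F = A + B ** L" and "G = C + D ** L"
  show ?thesis
    unfolding lyap_def F_def[symmetric] G_def[symmetric]
    by (simp add: transpose_add transpose_scalar symmetric_congruence assms)
qed

lemma symmetric_ups:
  assumes "transpose R = R" "transpose S = S" "transpose P = P"
  shows "transpose (ups B D R \<sigma> S P) = ups B D R \<sigma> S P"
  by (simp add: ups_def transpose_add transpose_scalar symmetric_congruence assms)

lemma qf_ups: "qf (ups B D R \<sigma> S P) u = qf R u + qf S (B *v u) + \<sigma>\<^sup>2 * qf P (D *v u)"
  by (simp add: ups_def qf_add qf_scaleR qf_congruence)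

lemma pos_def_ups:
  assumes "pos_def R" "pos_semidef S" "pos_semidef P"
  shows "pos_def (ups B D R \<sigma> S P)"
  using assms unfolding pos_def_iff pos_semidef_iff
  by (simp add: symmetric_ups qf_ups add_pos_nonneg)

lemma symmetric_ric:
  assumes "transpose Q = Q" "transpose R = R" "transpose S = S" "transpose P = P"
    and "invertible (ups B D R \<sigma> S P)"
  shows "transpose (ric A B C D Q R \<sigma> S P) = ric A B C D Q R \<sigma> S P"
  by (simp add: ric_def transpose_add transpose_diff transpose_scalar symmetric_congruence
      transpose_matrix_inv symmetric_ups assms)

text \<open>As a function of \<open>u\<close>, \<open>stage\<close> is a quadratic with leading form
  \<open>ups\<close> and mixed term \<open>cross\<close>; its vertex is at the gain and its minimum
  is \<open>ric\<close>.\<close>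

lemma stage_complete_square:
  assumes sym: "transpose R = R" "transpose S = S" "transpose P = P"
    and inv: "invertible (ups B D R \<sigma> S P)"
  shows "stage A B C D Q R \<sigma> S P x u =
    qf (ric A B C D Q R \<sigma> S P) x + qf (ups B D R \<sigma> S P) (u - gain A B C D R \<sigma> S P *v x)"
proof -
  define U where "U = ups B D R \<sigma> S P"
  define N where "N = cross A B C D \<sigma> S P"
  define g where "g = matrix_inv U *v (N *v x)"
  have Ug: "U *v g = N *v x"
    using inv by (simp add: g_def U_def matrix_vector_mul_assoc matrix_inv_right matrix_mul_assoc)
  have 1: "qf (ric A B C D Q R \<sigma> S P) x =
      qf Q x + qf S (A *v x) + \<sigma>\<^sup>2 * qf P (C *v x) - (N *v x) \<bullet> g"
    unfolding ric_def U_def[symmetric] N_def[symmetric] g_def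
    by (simp add: qf_add qf_diff qf_scaleR qf_congruence qf_def[of "matrix_inv U"])
  have 2: "u - gain A B C D R \<sigma> S P *v x = u + g"
    unfolding gain_def U_def[symmetric] N_def[symmetric] g_def
    by (simp add: matrix_vector_mul_assoc uminus_matrix_vector_mult)
  have 3: "qf U (u + g) = qf U u + 2 * (u \<bullet> (N *v x)) + g \<bullet> (N *v x)"
    using qf_add_vec[of U g u] symmetric_ups[OF sym] Ug by (simp add: U_def add.commute qf_def)
  have 4: "u \<bullet> (N *v x) =
      (B *v u) \<bullet> (S *v (A *v x)) + \<sigma>\<^sup>2 * ((D *v u) \<bullet> (P *v (C *v x)))"
    by (simp add: N_def cross_def matrix_vector_mult_add_rdistrib inner_add_right
        scaleR_matrix_vector_assoc[symmetric] inner_congruence)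
  have 5: "stage A B C D Q R \<sigma> S P x u =
      qf Q x + qf S (A *v x) + \<sigma>\<^sup>2 * qf P (C *v x) + 2 * (u \<bullet> (N *v x)) + qf U u"
    unfolding stage_def 4 U_def qf_ups qf_add_vec[OF sym(2)] qf_add_vec[OF sym(3)]
    by (simp add: algebra_simps)
  show ?thesis
    unfolding U_def[symmetric] 1 2 3 5 by (simp add: inner_commute)
qed

section \<open>Pairs of quadratic forms\<close>

declare split_paired_All [simp del]

type_synonym 'n mpair = "(real^'n^'n) \<times> (real^'n^'n)"

text \<open>A pair stands for a block diagonal form on (fluctuation, mean).\<close>

definition qp :: "'n::finite mpair \<Rightarrow> (real^'n) \<times> (real^'n) \<Rightarrow> real" where
  "qp X z = qf (fst X) (fst z) + qf (snd X) (snd z)"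

definition sym_pair :: "'n::finite mpair \<Rightarrow> bool" where
  "sym_pair X \<longleftrightarrow> transpose (fst X) = fst X \<and> transpose (snd X) = snd X"

definition psd_pair :: "'n::finite mpair \<Rightarrow> bool" where
  "psd_pair X \<longleftrightarrow> sym_pair X \<and> (\<forall>z. 0 \<le> qp X z)"

definition one_pair :: "'n::finite mpair" where
  "one_pair = (mat 1, mat 1)"

definition pbound :: "'n::finite mpair \<Rightarrow> real" where
  "pbound X = mbound (fst X) + mbound (snd X)"

lemma qp_add: "qp (X + Y) z = qp X z + qp Y z"
  by (simp add: qp_def qf_add)

lemma qp_diff: "qp (X - Y) z = qp X z - qp Y z"
  by (simp add: qp_def qf_diff)

lemma qp_scaleR: "qp (c *\<^sub>R X) z = c * qp X z"
  by (simp add: qp_def qf_scaleR algebra_simps)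

lemma qp_0 [simp]: "qp 0 z = 0"
  by (simp add: qp_def)

lemma qp_sum: "qp (\<Sum>i\<in>I. f i) z = (\<Sum>i\<in>I. qp (f i) z)"
  by (induction I rule: infinite_finite_induct) (auto simp: qp_add)

lemma qp_one [simp]: "qp one_pair z = z \<bullet> z"
  by (simp add: qp_def one_pair_def inner_prod_def)

lemma qp_fst [simp]: "qp X (x, 0) = qf (fst X) x"
  by (simp add: qp_def)

lemma qp_snd [simp]: "qp X (0, x) = qf (snd X) x"
  by (simp add: qp_def)

lemma sym_pair_simps [simp]:
  "sym_pair 0" "sym_pair one_pair"
  "sym_pair X \<Longrightarrow> sym_pair Y \<Longrightarrow> sym_pair (X + Y)"
  "sym_pair X \<Longrightarrow> sym_pair Y \<Longrightarrow> sym_pair (X - Y)"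
  "sym_pair X \<Longrightarrow> sym_pair (c *\<^sub>R X)"
  by (auto simp: sym_pair_def one_pair_def transpose_add transpose_diff transpose_scalar)

lemma sym_pair_sum: "(\<And>i. i \<in> I \<Longrightarrow> sym_pair (f i)) \<Longrightarrow> sym_pair (\<Sum>i\<in>I. f i)"
  by (induction I rule: infinite_finite_induct) auto

lemma pbound_nonneg: "0 \<le> pbound X"
  by (simp add: pbound_def mbound_nonneg)

lemma abs_qp_le: "\<bar>qp X z\<bar> \<le> pbound X * (z \<bullet> z)"
proof -
  have "\<bar>qp X z\<bar> \<le> mbound (fst X) * (fst z \<bullet> fst z) + mbound (snd X) * (snd z \<bullet> snd z)"
    unfolding qp_def by (rule order_trans[OF abs_triangle_ineq add_mono[OF abs_qf_le abs_qf_le]])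
  also have "\<dots> \<le> mbound (fst X) * (z \<bullet> z) + mbound (snd X) * (z \<bullet> z)"
    by (intro add_mono mult_left_mono mbound_nonneg) (auto simp: inner_prod_def)
  finally show ?thesis
    by (simp add: pbound_def algebra_simps)
qed

lemma qp_le_pbound: "qp X z \<le> pbound X * (z \<bullet> z)"
  using abs_qp_le[of X z] by linarith

lemma tendsto_pbound_0: "(f \<longlongrightarrow> 0) F \<Longrightarrow> ((\<lambda>j. pbound (f j)) \<longlongrightarrow> 0) F"
  unfolding pbound_def
  by (rule tendsto_add_zero; rule tendsto_mbound_0)
     (auto dest: tendsto_fst tendsto_snd)

text \<open>On a constant sequence this also gives extensionality: symmetric pairs with equal forms
  are equal.\<close>

lemma tendsto_sym_pairI:
  assumes "\<And>j. sym_pair (f j)" "sym_pair A" "\<And>z. ((\<lambda>j. qp (f j) z) \<longlongrightarrow> qp A z) F"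
  shows "(f \<longlongrightarrow> A) F"
proof -
  have "((\<lambda>j. fst (f j)) \<longlongrightarrow> fst A) F" "((\<lambda>j. snd (f j)) \<longlongrightarrow> snd A) F"
    using assms(1,2) assms(3)[of "(_, 0)"] assms(3)[of "(0, _)"]
    by (auto simp: sym_pair_def intro!: tendsto_symmetricI)
  from tendsto_Pair[OF this] show ?thesis
    by simp
qed

lemma tendsto_qp: "(f \<longlongrightarrow> A) F \<Longrightarrow> ((\<lambda>j. qp (f j) z) \<longlongrightarrow> qp A z) F"
  unfolding qp_def by (intro tendsto_intros)

lemma monotone_pair_limit:
  fixes f :: "nat \<Rightarrow> 'n::finite mpair"
  assumes sym: "\<And>j. sym_pair (f j)"
    and mono: "\<And>j z. qp (f j) z \<le> qp (f (Suc j)) z"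
    and bound: "\<And>j z. qp (f j) z \<le> b z"
  obtains A where "f \<longlonglongrightarrow> A" "sym_pair A" "\<And>j z. qp (f j) z \<le> qp A z"
proof -
  obtain A1 where 1: "(\<lambda>j. fst (f j)) \<longlonglongrightarrow> A1" "transpose A1 = A1" "\<And>j x. qf (fst (f j)) x \<le> qf A1 x"
    by (rule monotone_symmetric_limit[of "\<lambda>j. fst (f j)" "\<lambda>x. b (x, 0)"])
       (use sym mono[of _ "(_, 0)"] bound[of _ "(_, 0)"] in \<open>auto simp: sym_pair_def\<close>)
  obtain A2 where 2: "(\<lambda>j. snd (f j)) \<longlonglongrightarrow> A2" "transpose A2 = A2" "\<And>j x. qf (snd (f j)) x \<le> qf A2 x"
    by (rule monotone_symmetric_limit[of "\<lambda>j. snd (f j)" "\<lambda>x. b (0, x)"])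
       (use sym mono[of _ "(0, _)"] bound[of _ "(0, _)"] in \<open>auto simp: sym_pair_def\<close>)
  have "f \<longlonglongrightarrow> (A1, A2)"
    using tendsto_Pair[OF 1(1) 2(1)] by simp
  moreover have "qp (f j) z \<le> qp (A1, A2) z" for j z
    unfolding qp_def using 1(3) 2(3) by (auto intro: add_mono)
  ultimately show ?thesis
    using that[of "(A1, A2)"] 1(2) 2(2) by (simp add: sym_pair_def)
qed

lemma psd_pairD: "psd_pair X \<Longrightarrow> 0 \<le> qp X z"
  by (simp add: psd_pair_def)

lemma psd_pair_sym: "psd_pair X \<Longrightarrow> sym_pair X"
  by (simp add: psd_pair_def)

lemma psd_pair_add: "psd_pair X \<Longrightarrow> psd_pair Y \<Longrightarrow> psd_pair (X + Y)"
  by (simp add: psd_pair_def qp_add)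

lemma psd_pair_iff: "psd_pair X \<longleftrightarrow> pos_semidef (fst X) \<and> pos_semidef (snd X)"
  unfolding psd_pair_def sym_pair_def pos_semidef_iff
  by (metis add_nonneg_nonneg qp_def qp_fst qp_snd)

lemma pos_def_pair_coercive:
  assumes "sym_pair X" "\<And>z. z \<noteq> 0 \<Longrightarrow> 0 < qp X z"
  obtains \<epsilon> where "0 < \<epsilon>" "\<And>z. \<epsilon> * (z \<bullet> z) \<le> qp X z"
proof -
  have pd: "pos_def (fst X)" "pos_def (snd X)"
    using assms(1) assms(2)[of "(_, 0)"] assms(2)[of "(0, _)"]
    by (auto simp: pos_def_iff sym_pair_def zero_prod_def)
  obtain e1 where e1: "0 < e1" "\<And>x. e1 * (x \<bullet> x) \<le> qf (fst X) x"
    using pos_def_coercive[OF pd(1)] by blast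
  obtain e2 where e2: "0 < e2" "\<And>x. e2 * (x \<bullet> x) \<le> qf (snd X) x"
    using pos_def_coercive[OF pd(2)] by blast
  have "min e1 e2 * (z \<bullet> z) \<le> qp X z" for z
  proof -
    have "min e1 e2 * (fst z \<bullet> fst z) \<le> qf (fst X) (fst z)"
      by (rule order_trans[OF mult_right_mono e1(2)]) auto
    moreover have "min e1 e2 * (snd z \<bullet> snd z) \<le> qf (snd X) (snd z)"
      by (rule order_trans[OF mult_right_mono e2(2)]) auto
    ultimately show ?thesis
      by (simp add: qp_def inner_prod_def distrib_left)
  qed
  then show ?thesis
    using that[of "min e1 e2"] e1(1) e2(1) by simp
qed

section \<open>Positive operators on pairs\<close>

locale positive_operator =
  fixes T :: "'n::finite mpair \<Rightarrow> 'n mpair"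
  assumes linear: "linear T"
    and positive: "psd_pair X \<Longrightarrow> psd_pair (T X)"
    and symmetric: "sym_pair X \<Longrightarrow> sym_pair (T X)"
begin

lemma linear_funpow: "linear (T ^^ k)"
proof (induction k)
  case 0
  then show ?case
    using module_hom_ident by (simp add: linear_iff)
next
  case (Suc k)
  then show ?case
    unfolding funpow.simps(2) using linear by (rule linear_compose)
qed

lemmas add = linear_add[OF linear_funpow]
  and diff = linear_diff[OF linear_funpow]
  and scale = linear_scale[OF linear_funpow]
  and sum = linear_sum[OF linear_funpow]

lemma symmetric_funpow: "sym_pair X \<Longrightarrow> sym_pair ((T ^^ k) X)"
  by (induction k) (auto simp: symmetric)

lemma positive_funpow: "psd_pair X \<Longrightarrow> psd_pair ((T ^^ k) X)"
  by (induction k) (auto simp: positive)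

lemma mono_funpow:
  assumes "sym_pair X" "sym_pair Y" "\<And>z. qp X z \<le> qp Y z"
  shows "qp ((T ^^ k) X) z \<le> qp ((T ^^ k) Y) z"
proof -
  have "psd_pair ((T ^^ k) (Y - X))"
    using assms by (intro positive_funpow) (simp add: psd_pair_def qp_diff)
  then have "0 \<le> qp ((T ^^ k) (Y - X)) z"
    unfolding psd_pair_def by blast
  then show ?thesis
    by (simp add: diff qp_diff)
qed

lemma tendsto_funpow: "(f \<longlongrightarrow> A) F \<Longrightarrow> ((\<lambda>j. (T ^^ k) (f j)) \<longlongrightarrow> (T ^^ k) A) F"
  using linear_funpow[of k] by (simp add: linear_conv_bounded_linear bounded_linear.tendsto)

lemma psd_one: "psd_pair one_pair"
  by (simp add: psd_pair_def)

text \<open>Convergence gives some \<open>N\<close> at which the iterate is at most half of the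
  identity; positivity repeats this halving every \<open>N\<close> steps, which makes the decay
  geometric.\<close>

lemma partial_sums_bounded:
  assumes stable: "\<And>z. (\<lambda>k. qp ((T ^^ k) one_pair) z) \<longlonglongrightarrow> 0"
  obtains c where "0 \<le> c" "\<And>j z. (\<Sum>i<j. qp ((T ^^ i) one_pair) z) \<le> c * (z \<bullet> z)"
proof -
  have "(\<lambda>k. (T ^^ k) one_pair) \<longlonglongrightarrow> 0"
    by (rule tendsto_sym_pairI) (auto simp: symmetric_funpow stable)
  then have "(\<lambda>k. pbound ((T ^^ k) one_pair)) \<longlonglongrightarrow> 0"
    by (rule tendsto_pbound_0)
  then have "\<forall>\<^sub>F k in sequentially. pbound ((T ^^ k) one_pair) < 1/2"
    by (rule order_tendstoD) simp
  then obtain N where N: "pbound ((T ^^ N) one_pair) < 1/2"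
    by (auto simp: eventually_sequentially)
  have half: "qp ((T ^^ N) one_pair) z \<le> qp ((1/2) *\<^sub>R one_pair) z" for z
    using qp_le_pbound[of "(T ^^ N) one_pair" z] mult_right_mono[OF less_imp_le[OF N], of "z \<bullet> z"]
    by (simp add: qp_scaleR)
  define s where "s z i = qp ((T ^^ i) one_pair) z" for z i
  have s0: "0 \<le> s z i" for z i
    unfolding s_def by (intro psd_pairD positive_funpow psd_one)
  have sN: "s z (i + N) \<le> s z i / 2" for z i
    using mono_funpow[where k = i and z = z, OF _ _ half]
    by (simp add: s_def funpow_add scale qp_scaleR symmetric_funpow)
  \<comment> \<open>After the first \<open>N\<close> terms the sum is at most half of itself;
    absorbing that half gives the factor 2.\<close>
  have sums: "(\<Sum>i<j. s z i) \<le> 2 * (\<Sum>i<N. s z i)" for j z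
  proof -
    have "(\<Sum>i<j. s z i) \<le> (\<Sum>i<N + j. s z i)"
      by (rule sum_mono2) (auto simp: s0)
    also have "\<dots> = (\<Sum>i<N. s z i) + (\<Sum>i<j. s z (i + N))"
      by (induction j) (simp_all add: add_ac)
    also have "(\<Sum>i<j. s z (i + N)) \<le> (\<Sum>i<j. s z i / 2)"
      by (intro sum_mono sN)
    finally show ?thesis
      by (simp add: sum_divide_distrib[symmetric])
  qed
  have "(\<Sum>i<N. s z i) \<le> (\<Sum>i<N. pbound ((T ^^ i) one_pair)) * (z \<bullet> z)" for z
    unfolding s_def sum_distrib_right by (intro sum_mono qp_le_pbound)
  note bnd = this
  have "(\<Sum>i<j. s z i) \<le> 2 * (\<Sum>i<N. pbound ((T ^^ i) one_pair)) * (z \<bullet> z)" for j z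
    using order_trans[OF sums mult_left_mono[OF bnd]] by (simp add: mult.assoc)
  then show ?thesis
    using that[of "2 * (\<Sum>i<N. pbound ((T ^^ i) one_pair))"]
    by (simp add: s_def sum_nonneg pbound_nonneg)
qed

text \<open>The orbit sums of \<open>Q\<close> stay below \<open>V\<close>, so they converge; observability makes their limit
  positive definite, and \<open>T\<close> sends it to its own tails.\<close>

lemma lyapunov_stability:
  assumes V: "psd_pair V" "V = Q + T V" and Q: "psd_pair Q"
    and obs: "\<And>z. (\<And>k. qp ((T ^^ k) Q) z = 0) \<Longrightarrow> z = 0"
  shows "z \<noteq> 0 \<Longrightarrow> 0 < qp V z" and "(\<lambda>k. (T ^^ k) one_pair) \<longlonglongrightarrow> 0"
proof -
  define W where "W N = (\<Sum>k<N. (T ^^ k) Q)" for N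
  have psdQ: "psd_pair ((T ^^ k) Q)" for k
    by (rule positive_funpow[OF Q])
  have symW: "sym_pair (W N)" for N
    unfolding W_def using psdQ by (intro sym_pair_sum) (simp add: psd_pair_def)
  \<comment> \<open>Iterating \<open>V = Q + T V\<close> leaves a nonnegative remainder, so the
    partial sums stay below \<open>V\<close>.\<close>
  have VW: "V = W N + (T ^^ N) V" for N
  proof (induction N)
    case (Suc N)
    have step: "(T ^^ N) V = (T ^^ N) Q + (T ^^ Suc N) V"
      using arg_cong[OF V(2), of "T ^^ N"] by (simp only: add funpow_Suc_right comp_apply)
    have "W (Suc N) + (T ^^ Suc N) V = W N + (T ^^ N) V"
      by (simp only: W_def sum.lessThan_Suc add.assoc step)
    also have "\<dots> = V"
      by (rule Suc[symmetric])
    finally show ?case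
      by (rule sym)
  qed (simp add: W_def)
  have WV: "qp (W N) z \<le> qp V z" for N z
    using arg_cong[OF VW[of N], of "\<lambda>X. qp X z"] positive_funpow[OF V(1), of N]
    by (simp add: qp_add psd_pair_def)
  have monoW: "qp (W N) z \<le> qp (W (Suc N)) z" for N z
    using psdQ by (simp add: W_def qp_add psd_pair_def)
  obtain L where L: "W \<longlonglongrightarrow> L" "sym_pair L" "\<And>j z. qp (W j) z \<le> qp L z"
    using monotone_pair_limit[of W "qp V", OF symW monoW WV] by blast
  have posW: "\<exists>N. 0 < qp (W N) z" if "z \<noteq> 0" for z
  proof -
    obtain k where "qp ((T ^^ k) Q) z \<noteq> 0"
      using obs \<open>z \<noteq> 0\<close> by blast
    then have "0 < qp ((T ^^ k) Q) z"
      using psdQ[of k] by (simp add: psd_pair_def order_less_le)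
    also have "\<dots> \<le> qp (W (Suc k)) z"
      unfolding W_def qp_sum using psdQ by (intro member_le_sum) (auto simp: psd_pair_def)
    finally show ?thesis ..
  qed
  show "0 < qp V z" if "z \<noteq> 0" for z
    using posW[OF that] WV less_le_trans by blast
  have "0 < qp L z" if "z \<noteq> 0" for z
    using posW[OF that] L(3) less_le_trans by blast
  then obtain \<epsilon> where \<epsilon>: "0 < \<epsilon>" "\<And>z. \<epsilon> * (z \<bullet> z) \<le> qp L z"
    using pos_def_pair_coercive[OF L(2)] by blast
  \<comment> \<open>On partial sums \<open>T ^^ k\<close> drops the first \<open>k\<close> terms,
    and continuity carries this to \<open>L\<close>. The limit \<open>L\<close> is used rather than
    \<open>V\<close>, whose remainder \<open>(T ^^ k) V\<close> is not yet known to vanish.\<close>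
  have tail: "(T ^^ k) L = L - W k" for k
  proof -
    have "(T ^^ k) (W N) = W (N + k) - W k" for N
    proof -
      have "W (k + N) = W k + (\<Sum>i<N. (T ^^ (i + k)) Q)"
        unfolding W_def by (induction N) (auto simp: add.commute)
      moreover have "(T ^^ k) (W N) = (\<Sum>i<N. (T ^^ (i + k)) Q)"
        unfolding W_def sum by (intro sum.cong refl) (metis add.commute comp_apply funpow_add)
      ultimately show ?thesis
        by (simp add: add.commute)
    qed
    then have "(\<lambda>N. (T ^^ k) (W N)) \<longlonglongrightarrow> L - W k"
      using tendsto_diff[OF LIMSEQ_ignore_initial_segment[OF L(1), of k] tendsto_const] by simp
    then show ?thesis
      using LIMSEQ_unique[OF tendsto_funpow[OF L(1)]] by blast
  qed
  show "(\<lambda>k. (T ^^ k) one_pair) \<longlonglongrightarrow> 0"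
  proof (rule tendsto_sym_pairI)
    fix z
    \<comment> \<open>Coercivity puts \<open>one_pair\<close> below \<open>L\<close> divided by
      \<open>\<epsilon>\<close>; applying \<open>T ^^ k\<close> leaves a vanishing tail on the
      right.\<close>
    have le: "qp ((T ^^ k) one_pair) z \<le> qp L z / \<epsilon> - qp (W k) z / \<epsilon>" for k
    proof -
      have "qp ((T ^^ k) one_pair) z \<le> qp ((T ^^ k) ((1 / \<epsilon>) *\<^sub>R L)) z"
        using \<epsilon> L(2) by (intro mono_funpow) (auto simp: qp_scaleR field_simps)
      then show ?thesis
        by (simp add: scale tail qp_scaleR qp_diff diff_divide_distrib)
    qed
    have "(\<lambda>k. qp L z / \<epsilon> - qp (W k) z / \<epsilon>) \<longlonglongrightarrow> qp L z / \<epsilon> - qp L z / \<epsilon>"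
      by (intro tendsto_intros tendsto_qp L(1)) (use \<epsilon> in auto)
    then have lim: "(\<lambda>k. qp L z / \<epsilon> - qp (W k) z / \<epsilon>) \<longlonglongrightarrow> 0"
      by simp
    show "(\<lambda>k. qp ((T ^^ k) one_pair) z) \<longlonglongrightarrow> qp 0 z"
      unfolding qp_0
      by (rule tendsto_sandwich[OF _ _ tendsto_const lim])
         (use le positive_funpow[OF psd_one] in \<open>auto simp: psd_pair_def\<close>)
  qed (auto simp: symmetric_funpow)
qed

end

section \<open>The coupled Riccati operator\<close>

lemma lyap_add:
  "lyap A B C D 0 0 \<sigma> L (S + S') (P + P') = lyap A B C D 0 0 \<sigma> L S P + lyap A B C D 0 0 \<sigma> L S' P'"
proof -
  define F G where "F = A + B ** L" and "G = C + D ** L"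
  show ?thesis
    unfolding lyap_def F_def[symmetric] G_def[symmetric]
    by (simp add: matrix_add_ldistrib matrix_add_rdistrib_mult scaleR_add_right)
qed

lemma lyap_scaleR:
  "lyap A B C D 0 0 \<sigma> L (c *\<^sub>R S) (c *\<^sub>R P) = c *\<^sub>R lyap A B C D 0 0 \<sigma> L S P"
proof -
  define F G where "F = A + B ** L" and "G = C + D ** L"
  show ?thesis
    unfolding lyap_def F_def[symmetric] G_def[symmetric]
    by (simp add: scaleR_matrix_mult_left scaleR_matrix_mult_right scaleR_add_right)
qed

locale coupled_riccati =
  fixes A Ab C Cb Q Qb :: "real^'n^'n"
    and B Bb D Db :: "real^'m^'n"
    and R Rb :: "real^'m^'m" and \<sigma> :: real
  assumes R: "pos_def R" "pos_def (R + Rb)"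
    and Q: "pos_semidef Q" "pos_semidef (Q + Qb)"
begin

text \<open>A solution \<open>(P, Pb)\<close> is encoded as the pair \<open>(P, P + Pb)\<close> and a controller with gains
  \<open>(L, Lb)\<close> as \<open>(L, L + Lb)\<close>: the first components act on the fluctuation, the second
  ones on the mean. The noise feeds the mean into the fluctuation, which is why the first matrix
  also occurs in the second equation.\<close>

definition cl_op :: "real^'n^'m \<Rightarrow> real^'n^'m \<Rightarrow> 'n mpair \<Rightarrow> 'n mpair" where
  "cl_op L Lm X = (lyap A B C D 0 0 \<sigma> L (fst X) (fst X),
     lyap (A + Ab) (B + Bb) (C + Cb) (D + Db) 0 0 \<sigma> Lm (snd X) (fst X))"

definition cl_cost :: "real^'n^'m \<Rightarrow> real^'n^'m \<Rightarrow> 'n mpair" where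
  "cl_cost L Lm = (Q + transpose L ** R ** L, Q + Qb + transpose Lm ** (R + Rb) ** Lm)"

definition ric_op :: "'n mpair \<Rightarrow> 'n mpair" where
  "ric_op X = (ric A B C D Q R \<sigma> (fst X) (fst X),
     ric (A + Ab) (B + Bb) (C + Cb) (D + Db) (Q + Qb) (R + Rb) \<sigma> (snd X) (fst X))"

definition ups1 :: "'n mpair \<Rightarrow> real^'m^'m" where "ups1 X = ups B D R \<sigma> (fst X) (fst X)"
definition ups2 :: "'n mpair \<Rightarrow> real^'m^'m" where "ups2 X = ups (B + Bb) (D + Db) (R + Rb) \<sigma> (snd X) (fst X)"
definition gain1 :: "'n mpair \<Rightarrow> real^'n^'m" where "gain1 X = gain A B C D R \<sigma> (fst X) (fst X)"
definition gain2 :: "'n mpair \<Rightarrow> real^'n^'m" where "gain2 X = gain (A + Ab) (B + Bb) (C + Cb) (D + Db) (R + Rb) \<sigma> (snd X) (fst X)"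

lemma symmetric_data: "transpose R = R" "transpose (R + Rb) = R + Rb" "transpose Q = Q" "transpose (Q + Qb) = Q + Qb"
  using R Q by (auto simp: pos_def_def pos_semidef_def)

lemma qp_cl_op: "qp (cl_op L Lm X) (a, m) =
    qf (fst X) ((A + B ** L) *v a) + \<sigma>\<^sup>2 * qf (fst X) ((C + D ** L) *v a) +
    qf (snd X) ((A + Ab + (B + Bb) ** Lm) *v m) + \<sigma>\<^sup>2 * qf (fst X) ((C + Cb + (D + Db) ** Lm) *v m)"
  by (simp add: qp_def cl_op_def qf_lyap stage_def matrix_vector_mult_add_rdistrib matrix_vector_mul_assoc)

lemma qp_cl_cost: "qp (cl_cost L Lm) (a, m) =
    qf Q a + qf R (L *v a) + qf (Q + Qb) m + qf (R + Rb) (Lm *v m)"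
  by (simp add: qp_def cl_cost_def qf_add qf_congruence)

lemma psd_cl_cost: "psd_pair (cl_cost L Lm)"
proof -
  have "0 \<le> qp (cl_cost L Lm) (a, m)" for a m
    unfolding qp_cl_cost using R[THEN pos_def_imp_semidef] Q by (simp add: pos_semidef_iff)
  then show ?thesis
    using symmetric_data
    by (auto simp: psd_pair_def sym_pair_def cl_cost_def transpose_add[of _ "_ ** _"] symmetric_congruence)
qed

lemma positive_operator_cl_op: "positive_operator (cl_op L Lm)"
proof (rule positive_operator.intro)
  show "linear (cl_op L Lm)"
    by (rule linearI) (simp_all add: cl_op_def lyap_add lyap_scaleR)
  show sym: "sym_pair (cl_op L Lm X)" if "sym_pair X" for X
    using that by (auto simp: sym_pair_def cl_op_def intro!: symmetric_lyap)
  show "psd_pair (cl_op L Lm X)" if "psd_pair X" for X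
  proof -
    have "0 \<le> qp (cl_op L Lm X) (a, m)" for a m
      using that unfolding qp_cl_op psd_pair_iff pos_semidef_iff by simp
    then show ?thesis
      using sym that by (auto simp: psd_pair_def)
  qed
qed

context
  fixes X :: "'n mpair" assumes X: "psd_pair X"
begin

lemma pos_def_ups1: "pos_def (ups1 X)"
  unfolding ups1_def using R X by (simp add: pos_def_ups psd_pair_iff)

lemma pos_def_ups2: "pos_def (ups2 X)"
  unfolding ups2_def using R X by (simp add: pos_def_ups psd_pair_iff)

text \<open>Fluctuation and mean are minimized at once, because \<open>L\<close> and
  \<open>Lm\<close> enter separate squares.\<close>

lemma qp_complete_square:
  "qp (cl_cost L Lm + cl_op L Lm X) (a, m) = qp (ric_op X) (a, m)
     + qf (ups1 X) (L *v a - gain1 X *v a) + qf (ups2 X) (Lm *v m - gain2 X *v m)"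
proof -
  have sym: "transpose (fst X) = fst X" "transpose (snd X) = snd X"
    using X by (auto simp: psd_pair_def sym_pair_def)
  note inv = pos_def_ups1[THEN invertible_pos_def, unfolded ups1_def]
    pos_def_ups2[THEN invertible_pos_def, unfolded ups2_def]
  have "qp (cl_cost L Lm + cl_op L Lm X) (a, m) =
      stage A B C D Q R \<sigma> (fst X) (fst X) a (L *v a)
      + stage (A + Ab) (B + Bb) (C + Cb) (D + Db) (Q + Qb) (R + Rb) \<sigma> (snd X) (fst X) m (Lm *v m)"
    unfolding qp_add qp_cl_cost qp_cl_op stage_def
    by (simp add: matrix_vector_mult_add_rdistrib matrix_vector_mul_assoc)
  then show ?thesis
    unfolding stage_complete_square[OF symmetric_data(1) sym(1,1) inv(1)]
      stage_complete_square[OF symmetric_data(2) sym(2,1) inv(2)]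
    by (simp add: qp_def ric_op_def ups1_def ups2_def gain1_def gain2_def)
qed

lemma ric_op_le: "qp (ric_op X) z \<le> qp (cl_cost L Lm + cl_op L Lm X) z"
  using qp_complete_square[of L Lm "fst z" "snd z"]
    pos_def_ups1[THEN pos_def_imp_semidef] pos_def_ups2[THEN pos_def_imp_semidef]
  by (simp add: pos_semidef_iff)

lemma ric_op_eq: "qp (ric_op X) z = qp (cl_cost (gain1 X) (gain2 X) + cl_op (gain1 X) (gain2 X) X) z"
  using qp_complete_square[of "gain1 X" "gain2 X" "fst z" "snd z"] by simp

lemma psd_ric_op: "psd_pair (ric_op X)"
proof -
  have "sym_pair (ric_op X)"
    using X symmetric_data pos_def_ups1[THEN invertible_pos_def] pos_def_ups2[THEN invertible_pos_def]
    by (auto simp: sym_pair_def psd_pair_def ric_op_def ups1_def ups2_def intro!: symmetric_ric)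
  moreover have "psd_pair (cl_cost (gain1 X) (gain2 X) + cl_op (gain1 X) (gain2 X) X)"
    by (intro psd_pair_add psd_cl_cost positive_operator.positive[OF positive_operator_cl_op] X)
  ultimately show ?thesis
    by (simp add: psd_pair_def ric_op_eq)
qed

end

section \<open>Monotonicity and continuity of the Riccati operator, and value iteration\<close>

lemma cl_op_mono:
  assumes "sym_pair X" "sym_pair Y" "\<And>z. qp X z \<le> qp Y z"
  shows "qp (cl_op L Lm X) z \<le> qp (cl_op L Lm Y) z"
  using positive_operator.mono_funpow[OF positive_operator_cl_op assms, of 1] by simp

text \<open>A minimum of monotone maps is monotone: freeze the gains that are optimal for
  \<open>Y\<close>, which are merely admissible for \<open>X\<close>.\<close>

lemma ric_op_mono:
  assumes "psd_pair X" "psd_pair Y" "\<And>z. qp X z \<le> qp Y z"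
  shows "qp (ric_op X) z \<le> qp (ric_op Y) z"
proof -
  have "qp (ric_op X) z \<le> qp (cl_cost (gain1 Y) (gain2 Y) + cl_op (gain1 Y) (gain2 Y) X) z"
    by (rule ric_op_le[OF assms(1)])
  also have "\<dots> \<le> qp (ric_op Y) z"
    unfolding ric_op_eq[OF assms(2)] qp_add
    using assms by (intro add_left_mono cl_op_mono) (auto simp: psd_pair_def)
  finally show ?thesis .
qed

text \<open>Semidefinite \<open>S j\<close> and \<open>P j\<close> only add to \<open>R'\<close>,
  whose coercivity constant is therefore the uniform one required by
  \<open>tendsto_matrix_inv\<close>.\<close>

lemma tendsto_ups_inv:
  fixes R' :: "real^'m^'m" and B' D' :: "real^'m^'n"
  assumes "pos_def R'" "S \<longlonglongrightarrow> S'" "P \<longlonglongrightarrow> P'" "\<And>j. pos_semidef (S j)" "\<And>j. pos_semidef (P j)"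
    "pos_semidef S'" "pos_semidef P'"
  shows "(\<lambda>j. matrix_inv (ups B' D' R' \<sigma> (S j) (P j))) \<longlonglongrightarrow> matrix_inv (ups B' D' R' \<sigma> S' P')"
proof -
  obtain \<epsilon> where \<epsilon>: "0 < \<epsilon>" "\<And>x. \<epsilon> * (x \<bullet> x) \<le> qf R' x"
    using pos_def_coercive[OF assms(1)] by blast
  show ?thesis
  proof (rule tendsto_matrix_inv[OF _ _ _ \<epsilon>(1)])
    show "\<epsilon> * (v \<bullet> v) \<le> qf (ups B' D' R' \<sigma> (S j) (P j)) v" for j v
      using \<epsilon>(2)[of v] assms(4)[of j] assms(5)[of j]
      by (simp add: qf_ups pos_semidef_iff add_increasing2)
    show "(\<lambda>j. ups B' D' R' \<sigma> (S j) (P j)) \<longlonglongrightarrow> ups B' D' R' \<sigma> S' P'"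
      unfolding ups_def by (intro tendsto_intros assms)
  qed (intro invertible_pos_def pos_def_ups assms)+
qed

lemma tendsto_ric_op:
  assumes "V \<longlonglongrightarrow> X" "\<And>j. psd_pair (V j)" "psd_pair X"
  shows "(\<lambda>j. ric_op (V j)) \<longlonglongrightarrow> ric_op X"
  unfolding ric_op_def ric_def cross_def
  using assms R
  by (intro tendsto_intros tendsto_ups_inv tendsto_fst tendsto_snd) (auto simp: psd_pair_iff)

lemma ric_op_fixpoint:
  assumes X: "psd_pair X" "ric_op X = X"
  shows "X = cl_cost (gain1 X) (gain2 X) + cl_op (gain1 X) (gain2 X) X"
proof -
  have "psd_pair (cl_cost (gain1 X) (gain2 X) + cl_op (gain1 X) (gain2 X) X)" (is "psd_pair ?Y")
    by (intro psd_pair_add psd_cl_cost positive_operator.positive[OF positive_operator_cl_op] X)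
  \<comment> \<open>Equal forms make a constant sequence converge to both pairs, so the pairs
    agree.\<close>
  then have "(\<lambda>_::nat. X) \<longlonglongrightarrow> ?Y"
    using X ric_op_eq[OF X(1)] by (intro tendsto_sym_pairI) (auto simp: psd_pair_def)
  then show ?thesis
    using LIMSEQ_unique tendsto_const by blast
qed

lemma riccati_exists:
  assumes stable: "\<And>z. (\<lambda>k. qp ((cl_op L Lm ^^ k) one_pair) z) \<longlonglongrightarrow> 0"
  obtains X where "psd_pair X" "ric_op X = X"
proof -
  interpret op: positive_operator "cl_op L Lm"
    by (rule positive_operator_cl_op)
  define V where "V j = (ric_op ^^ j) 0" for j
  have V_Suc: "V (Suc j) = ric_op (V j)" for j
    by (simp add: V_def)
  have psd: "psd_pair (V j)" for j
    by (induction j) (simp_all add: V_def psd_ric_op, simp add: psd_pair_def)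
  have mono: "qp (V j) z \<le> qp (V (Suc j)) z" for j z
  proof (induction j arbitrary: z)
    case 0
    show ?case
      using psd[of 1] by (simp add: V_def psd_pair_def)
  next
    case (Suc j)
    then show ?case
      unfolding V_Suc[of "Suc j"] V_Suc[of j] using psd V_Suc by (metis ric_op_mono)
  qed
  \<comment> \<open>The cost of the given gain over \<open>j\<close> steps; \<open>V j\<close> is
    the optimal cost over \<open>j\<close> steps.\<close>
  define W where "W j = (\<Sum>i<j. (cl_op L Lm ^^ i) (cl_cost L Lm))" for j
  have symW: "sym_pair (W j)" for j
    unfolding W_def using psd_cl_cost
    by (intro sym_pair_sum op.symmetric_funpow) (auto simp: psd_pair_def)
  have W_Suc: "W (Suc j) = cl_cost L Lm + cl_op L Lm (W j)" for j
    unfolding W_def by (simp add: sum.lessThan_Suc_shift op.sum[of 1, simplified] del: sum.lessThan_Suc)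
  have VW: "qp (V j) z \<le> qp (W j) z" for j z
  proof (induction j arbitrary: z)
    case (Suc j)
    have "qp (V (Suc j)) z \<le> qp (cl_cost L Lm + cl_op L Lm (V j)) z"
      unfolding V_Suc by (rule ric_op_le[OF psd])
    also have "\<dots> \<le> qp (W (Suc j)) z"
      unfolding W_Suc qp_add using Suc psd symW
      by (intro add_left_mono cl_op_mono) (auto simp: psd_pair_def)
    finally show ?case .
  qed (simp add: V_def W_def)
  obtain c where c: "0 \<le> c" "\<And>j z. (\<Sum>i<j. qp ((cl_op L Lm ^^ i) one_pair) z) \<le> c * (z \<bullet> z)"
    using op.partial_sums_bounded[OF stable] by blast
  \<comment> \<open>The stage cost is at most \<open>b\<close> times the identity pair, so the orbit
    bound \<open>c\<close> for the latter bounds every \<open>W j\<close>.\<close>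
  define b where "b = pbound (cl_cost L Lm)"
  have "qp (W j) z \<le> b * (c * (z \<bullet> z))" for j z
  proof -
    have "qp ((cl_op L Lm ^^ i) (cl_cost L Lm)) z \<le> b * qp ((cl_op L Lm ^^ i) one_pair) z" for i
      using op.mono_funpow[of "cl_cost L Lm" "b *\<^sub>R one_pair" i z] psd_pair_sym[OF psd_cl_cost]
        qp_le_pbound[of "cl_cost L Lm"]
      by (simp add: qp_scaleR op.scale b_def)
    then have "qp (W j) z \<le> b * (\<Sum>i<j. qp ((cl_op L Lm ^^ i) one_pair) z)"
      unfolding W_def qp_sum sum_distrib_left by (rule sum_mono)
    also have "\<dots> \<le> b * (c * (z \<bullet> z))"
      by (intro mult_left_mono c) (simp add: b_def pbound_nonneg)
    finally show ?thesis .
  qed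
  then have bound: "qp (V j) z \<le> b * (c * (z \<bullet> z))" for j z
    using VW order_trans by blast
  obtain X where X: "V \<longlonglongrightarrow> X" "sym_pair X" "\<And>j z. qp (V j) z \<le> qp X z"
    using monotone_pair_limit[of V "\<lambda>z. b * (c * (z \<bullet> z))", OF psd_pair_sym[OF psd] mono bound]
    by blast
  have psdX: "psd_pair X"
    using X(2) X(3)[of 0] by (simp add: psd_pair_def V_def)
  have "(\<lambda>j. V (Suc j)) \<longlonglongrightarrow> ric_op X"
    unfolding V_Suc by (rule tendsto_ric_op[OF X(1) psd psdX])
  then have "ric_op X = X"
    using LIMSEQ_unique LIMSEQ_Suc[OF X(1)] by blast
  with psdX that show ?thesis
    by blast
qed

end

section \<open>Square-integrable random vectors\<close>

lemma borel_measurable_matrix_vector [measurable (raw)]: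
  fixes f :: "'s \<Rightarrow> real^'n"
  assumes "f \<in> borel_measurable N"
  shows "(\<lambda>x. A *v f x) \<in> borel_measurable N"
proof -
  have "(*v) A \<in> borel_measurable borel"
    by (intro borel_measurable_continuous_onI linear_continuous_on matrix_vector_mul_bounded_linear)
  then show ?thesis
    using assms by (rule measurable_compose[rotated])
qed

lemma borel_measurable_qf [measurable (raw)]:
  "f \<in> borel_measurable N \<Longrightarrow> (\<lambda>x. qf P (f x)) \<in> borel_measurable N"
  unfolding qf_def by (intro borel_measurable_inner borel_measurable_matrix_vector)

definition sqint :: "'s measure \<Rightarrow> ('s \<Rightarrow> real^'n) \<Rightarrow> bool" where
  "sqint M x \<longleftrightarrow> x \<in> borel_measurable M \<and> integrable M (\<lambda>\<omega>. x \<omega> \<bullet> x \<omega>)"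

context prob_space
begin

lemma sqint_integrable_inner:
  assumes "sqint M x" "sqint M y"
  shows "integrable M (\<lambda>\<omega>. x \<omega> \<bullet> y \<omega>)"
proof (rule Bochner_Integration.integrable_bound)
  show "integrable M (\<lambda>\<omega>. x \<omega> \<bullet> x \<omega> + y \<omega> \<bullet> y \<omega>)"
    using assms by (simp add: sqint_def)
  have "norm (x \<omega> \<bullet> y \<omega>) \<le> x \<omega> \<bullet> x \<omega> + y \<omega> \<bullet> y \<omega>" for \<omega>
  proof -
    have "0 \<le> (x \<omega> - y \<omega>) \<bullet> (x \<omega> - y \<omega>)" "0 \<le> (x \<omega> + y \<omega>) \<bullet> (x \<omega> + y \<omega>)"
      "0 \<le> x \<omega> \<bullet> x \<omega>" "0 \<le> y \<omega> \<bullet> y \<omega>"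
      by simp_all
    then show ?thesis
      unfolding inner_add_left inner_add_right inner_diff_left inner_diff_right inner_commute[of "y \<omega>" "x \<omega>"]
      by (simp add: abs_le_iff)
  qed
  then show "AE \<omega> in M. norm (x \<omega> \<bullet> y \<omega>) \<le> norm (x \<omega> \<bullet> x \<omega> + y \<omega> \<bullet> y \<omega>)"
    by (intro AE_I2) (metis abs_ge_self order_trans real_norm_def)
qed (use assms in \<open>auto simp: sqint_def\<close>)

lemma sqint_const [simp, intro]: "sqint M (\<lambda>_. c)"
  by (simp add: sqint_def)

lemma sqint_add [intro]:
  assumes "sqint M x" "sqint M y"
  shows "sqint M (\<lambda>\<omega>. x \<omega> + y \<omega>)"
  using sqint_integrable_inner[OF assms] sqint_integrable_inner[OF assms(2,1)] assms
  by (auto simp: sqint_def inner_add_left inner_add_right)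

lemma sqint_diff [intro]:
  assumes "sqint M x" "sqint M y"
  shows "sqint M (\<lambda>\<omega>. x \<omega> - y \<omega>)"
  using sqint_integrable_inner[OF assms] sqint_integrable_inner[OF assms(2,1)] assms
  by (auto simp: sqint_def inner_diff_left inner_diff_right)

lemma sqint_matrix [intro]:
  assumes "sqint M x"
  shows "sqint M (\<lambda>\<omega>. A *v x \<omega>)"
proof -
  have "integrable M (\<lambda>\<omega>. (A *v x \<omega>) \<bullet> (A *v x \<omega>))"
  proof (rule Bochner_Integration.integrable_bound)
    show "integrable M (\<lambda>\<omega>. (mbound A)\<^sup>2 * (x \<omega> \<bullet> x \<omega>))"
      using assms by (simp add: sqint_def)
    have "(A *v x \<omega>) \<bullet> (A *v x \<omega>) \<le> (mbound A)\<^sup>2 * (x \<omega> \<bullet> x \<omega>)" for \<omega>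
      using power_mono[OF norm_mult_le_mbound norm_ge_zero, of A "x \<omega>" 2]
      by (simp add: dot_square_norm power_mult_distrib)
    then show "AE \<omega> in M. norm ((A *v x \<omega>) \<bullet> (A *v x \<omega>)) \<le> norm ((mbound A)\<^sup>2 * (x \<omega> \<bullet> x \<omega>))"
      by (intro AE_I2) simp
  qed (use assms in \<open>auto simp: sqint_def\<close>)
  then show ?thesis
    using assms by (auto simp: sqint_def)
qed

lemma sqint_integrable [intro]:
  assumes "sqint M x"
  shows "integrable M x"
proof -
  have "integrable M (\<lambda>\<omega>. x \<omega> \<bullet> axis i 1)" for i
    by (rule sqint_integrable_inner[OF assms sqint_const])
  then have "integrable M (\<lambda>\<omega>. \<Sum>b\<in>Basis. (x \<omega> \<bullet> b) *\<^sub>R b)"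
    by (intro Bochner_Integration.integrable_sum integrable_scaleR_left) (auto simp: Basis_vec_def)
  then show ?thesis
    by (simp add: euclidean_representation)
qed

lemma sqint_integrable_qf [intro]: "sqint M x \<Longrightarrow> integrable M (\<lambda>\<omega>. qf P (x \<omega>))"
  unfolding qf_def by (intro sqint_integrable_inner sqint_matrix)

lemma expectation_matrix:
  "sqint M x \<Longrightarrow> expectation (\<lambda>\<omega>. A *v x \<omega>) = A *v expectation x"
  by (intro integral_bounded_linear matrix_vector_mul_bounded_linear sqint_integrable)

lemma expectation_centered: "sqint M x \<Longrightarrow> expectation (\<lambda>\<omega>. x \<omega> - expectation x) = 0"
  by (simp add: sqint_integrable prob_space)

text \<open>The mixed term is linear in the centred vector \<open>x\<close> and has mean 0.\<close>

lemma expectation_qf_shift: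
  assumes x: "sqint M x" "expectation x = 0" and P: "transpose P = P"
  shows "expectation (\<lambda>\<omega>. qf P (x \<omega> + c)) = expectation (\<lambda>\<omega>. qf P (x \<omega>)) + qf P c"
proof -
  have "expectation (\<lambda>\<omega>. c \<bullet> (P *v x \<omega>)) = c \<bullet> (P *v expectation x)"
    unfolding expectation_matrix[OF x(1), symmetric]
    by (intro integral_inner_right sqint_integrable sqint_matrix x(1))
  moreover have "integrable M (\<lambda>\<omega>. c \<bullet> (P *v x \<omega>))"
    by (intro integrable_inner_right sqint_integrable sqint_matrix x(1))
  ultimately show ?thesis
    using sqint_integrable_qf[OF x(1), of P] by (simp add: qf_add_vec[OF P] x(2) prob_space)
qed

section \<open>Values of pairs at random vectors\<close>

definition val :: "'n::finite mpair \<Rightarrow> ('a \<Rightarrow> real^'n) \<Rightarrow> real" where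
  "val X x = expectation (\<lambda>\<omega>. qf (fst X) (x \<omega> - expectation x)) + qf (snd X) (expectation x)"

text \<open>As the expectation of \<open>qp\<close> at (fluctuation, mean), \<open>val\<close>
  inherits pointwise inequalities between forms.\<close>

lemma val_eq_expectation:
  assumes x: "sqint M x"
  shows "val X x = expectation (\<lambda>\<omega>. qp X (x \<omega> - expectation x, expectation x))"
  using sqint_integrable_qf[OF sqint_diff[OF x sqint_const]] by (simp add: val_def qp_def prob_space)

lemma val_mono:
  assumes x: "sqint M x" and "\<And>z. qp X z \<le> qp Y z"
  shows "val X x \<le> val Y x"
  unfolding val_eq_expectation[OF x] unfolding qp_def fst_conv snd_conv
  by (intro integral_mono Bochner_Integration.integrable_add sqint_integrable_qf sqint_diff
      sqint_const x assms(2)[unfolded qp_def, of "(_, _)", simplified])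

lemma val_add: "sqint M x \<Longrightarrow> val (X + Y) x = val X x + val Y x"
  by (simp add: val_def qf_add sqint_integrable_qf[OF sqint_diff[OF _ sqint_const]])

lemma val_scaleR: "sqint M x \<Longrightarrow> val (c *\<^sub>R X) x = c * val X x"
  by (simp add: val_def qf_scaleR algebra_simps)

lemma val_0 [simp]: "val 0 x = 0"
  by (simp add: val_def)

lemma val_nonneg: "sqint M x \<Longrightarrow> (\<And>z. 0 \<le> qp X z) \<Longrightarrow> 0 \<le> val X x"
  using val_mono[of x 0 X] by simp

lemma second_moment:
  assumes x: "sqint M x" and P: "transpose P = P"
  shows "expectation (\<lambda>\<omega>. qf P (F *v x \<omega> + c)) =
    expectation (\<lambda>\<omega>. qf P (F *v (x \<omega> - expectation x))) + qf P (F *v expectation x + c)"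
proof -
  have sq: "sqint M (\<lambda>\<omega>. x \<omega> - expectation x)"
    using x by auto
  then have "sqint M (\<lambda>\<omega>. F *v (x \<omega> - expectation x))"
    by (rule sqint_matrix)
  then have "expectation (\<lambda>\<omega>. qf P (F *v (x \<omega> - expectation x) + (F *v expectation x + c))) =
    expectation (\<lambda>\<omega>. qf P (F *v (x \<omega> - expectation x))) + qf P (F *v expectation x + c)"
    by (rule expectation_qf_shift[OF _ _ P]) (simp add: expectation_matrix[OF sq] expectation_centered[OF x])
  then show ?thesis
    by (simp add: matrix_vector_mult_diff_distrib)
qed

text \<open>The origin of the second component \<open>P + Pb\<close>: splitting the mean off
  \<open>E(x'Px)\<close> adds a \<open>P\<close>-term in the mean to the
  \<open>Pb\<close>-term.\<close>

lemma expectation_qf_pair: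
  assumes x: "sqint M x" and P: "transpose P = P"
  shows "expectation (\<lambda>\<omega>. qf P (x \<omega>)) + qf Pb (expectation x) = val (P, P + Pb) x"
  using second_moment[OF x P, of "mat 1" 0] by (simp add: val_def qf_add)

lemma expectation_norm_val:
  assumes x: "sqint M x"
  shows "expectation (\<lambda>\<omega>. x \<omega> \<bullet> x \<omega>) = val one_pair x"
  using expectation_qf_pair[OF x, of "mat 1" 0] by (simp add: one_pair_def)

lemma val_tendsto_0:
  assumes x: "sqint M x" and f: "f \<longlonglongrightarrow> 0"
  shows "(\<lambda>k. val (f k) x) \<longlonglongrightarrow> 0"
proof (rule Lim_null_comparison[rotated])
  show "(\<lambda>k. pbound (f k) * val one_pair x) \<longlonglongrightarrow> 0"
    using tendsto_pbound_0[OF f] by (rule tendsto_mult_left_zero)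
  have "\<bar>val (f k) x\<bar> \<le> pbound (f k) * val one_pair x" for k
  proof -
    have "qp (f k) z \<le> qp (pbound (f k) *\<^sub>R one_pair) z" "qp (- (pbound (f k)) *\<^sub>R one_pair) z \<le> qp (f k) z" for z
      using abs_qp_le[of "f k" z] by (simp_all only: qp_scaleR qp_one abs_le_iff) linarith+
    from val_mono[OF x this(1)] val_mono[OF x this(2)] show ?thesis
      by (simp only: val_scaleR[OF x] abs_le_iff) simp
  qed
  then show "\<forall>\<^sub>F k in sequentially. norm (val (f k) x) \<le> pbound (f k) * val one_pair x"
    by simp
qed

section \<open>The noise is independent of the past\<close>

definition source :: "(nat \<Rightarrow> 'a \<Rightarrow> real) \<Rightarrow> ('a \<Rightarrow> real^'n) \<Rightarrow> nat option \<Rightarrow> 'a set set" where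
  "source w x0 i = (case i of
      None \<Rightarrow> sets (vimage_algebra (space M) x0 borel)
    | Some k \<Rightarrow> sets (vimage_algebra (space M) (w k) borel))"

text \<open>The information without the null sets, so that independence of the next noise is pure
  grouping of independent generators; \<open>measurable_past_information\<close> restores the null
  sets.\<close>

definition past :: "(nat \<Rightarrow> 'a \<Rightarrow> real) \<Rightarrow> ('a \<Rightarrow> real^'n) \<Rightarrow> nat \<Rightarrow> 'a measure" where
  "past w x0 k = sigma (space M) (\<Union>i\<in>insert None (Some ` {..<k}). source w x0 i)"

lemma source_subset: "source w x0 i \<subseteq> Pow (space M)"
  using sets.sets_into_space by (force simp: source_def split: option.splits)

lemma space_past [simp]: "space (past w x0 k) = space M"
  unfolding past_def by (rule space_measure_of) (use source_subset in blast)

lemma sets_past: "sets (past w x0 k) = sigma_sets (space M) (\<Union>i\<in>insert None (Some ` {..<k}). source w x0 i)"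
  unfolding past_def by (rule sets_measure_of) (use source_subset in blast)

lemma source_subset_past: "i \<in> insert None (Some ` {..<k}) \<Longrightarrow> source w x0 i \<subseteq> sets (past w x0 k)"
  unfolding sets_past by (intro subsetI sigma_sets.Basic) blast

lemma measurable_past_initial: "x0 \<in> borel_measurable (past w x0 k)"
proof -
  have "x0 \<in> borel_measurable (vimage_algebra (space M) x0 borel)"
    by (rule measurable_vimage_algebra1) simp
  moreover have "sets (vimage_algebra (space M) x0 borel) \<subseteq> sets (past w x0 k)"
    using source_subset_past[of None k w x0] by (simp add: source_def)
  ultimately show ?thesis
    using measurable_mono[of borel borel "vimage_algebra (space M) x0 borel" "past w x0 k"] by auto
qed

lemma measurable_past_noise:
  assumes "i < k" shows "w i \<in> borel_measurable (past w x0 k)"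
proof -
  have "w i \<in> borel_measurable (vimage_algebra (space M) (w i) borel)"
    by (rule measurable_vimage_algebra1) simp
  moreover have "sets (vimage_algebra (space M) (w i) borel) \<subseteq> sets (past w x0 k)"
    using source_subset_past[of "Some i" k w x0] assms by (simp add: source_def)
  ultimately show ?thesis
    using measurable_mono[of borel borel "vimage_algebra (space M) (w i) borel" "past w x0 k"] by auto
qed

lemma measurable_past_Suc: "f \<in> borel_measurable (past w x0 k) \<Longrightarrow> f \<in> borel_measurable (past w x0 (Suc k))"
proof -
  have "sets (past w x0 k) \<subseteq> sets (past w x0 (Suc k))"
    unfolding sets_past by (rule sigma_sets_mono') auto
  then show "f \<in> borel_measurable (past w x0 k) \<Longrightarrow> f \<in> borel_measurable (past w x0 (Suc k))"
    using measurable_mono[of borel borel "past w x0 k" "past w x0 (Suc k)"] by auto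
qed

lemma measurable_past_information:
  assumes "f \<in> borel_measurable (past w x0 k)"
  shows "f \<in> borel_measurable (information M w x0 k)"
proof -
  define G where "G = sets (vimage_algebra (space M) x0 borel) \<union>
      (\<Union>i<k. sets (vimage_algebra (space M) (w i) borel)) \<union> null_sets M"
  have "(\<Union>i\<in>insert None (Some ` {..<k}). source w x0 i) \<subseteq> G"
    by (auto simp: G_def source_def)
  moreover have "G \<subseteq> Pow (space M)"
    using sets.sets_into_space by (force simp: G_def null_sets_def)
  ultimately have "sets (past w x0 k) \<subseteq> sets (information M w x0 k)"
    unfolding sets_past information_def G_def[symmetric] by (simp add: sigma_sets_mono')
  moreover have "space (information M w x0 k) = space M"
    using \<open>G \<subseteq> Pow (space M)\<close> unfolding information_def G_def[symmetric] by simp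
  ultimately show ?thesis
    using assms measurable_mono[of borel borel "past w x0 k" "information M w x0 k"] by auto
qed

context
  fixes w :: "nat \<Rightarrow> 'a \<Rightarrow> real" and x0 :: "'a \<Rightarrow> real^'n"
  assumes x0: "initial_state M w x0"
begin

lemma indep_sources: "indep_sets (source w x0) UNIV"
  using x0 by (simp add: initial_state_def source_def[abs_def])

lemma sets_past_subset: "sets (past w x0 k) \<subseteq> events"
proof -
  have "source w x0 i \<subseteq> events" for i
    using indep_sources by (auto simp: indep_sets_def)
  then show ?thesis
    unfolding sets_past by (intro sets.sigma_sets_subset) blast
qed

lemma measurable_past_M: "f \<in> borel_measurable (past w x0 k) \<Longrightarrow> f \<in> borel_measurable M"
  using measurable_mono[of borel borel "past w x0 k" M] sets_past_subset by auto

text \<open>The initial state with the earlier noise forms one block of independent generators,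
  \<open>w k\<close> another; disjoint blocks generate independent sigma-algebras.\<close>

lemma indep_past_noise:
  fixes f :: "'a \<Rightarrow> real"
  assumes f: "f \<in> borel_measurable (past w x0 k)" and w: "w k \<in> borel_measurable M"
  shows "indep_var borel f borel (w k)"
proof -
  define I where "I b = (if b then insert None (Some ` {..<k}) else {Some k})" for b
  have "indep_sets (\<lambda>b. sigma_sets (space M) (\<Union>i\<in>I b. source w x0 i)) UNIV"
  proof (rule indep_sets_collect_sigma)
    show "indep_sets (source w x0) (\<Union>b. I b)"
      by (rule indep_sets_mono_index[OF _ indep_sources]) auto
    show "Int_stable (source w x0 i)" for i
      by (cases i) (auto simp: source_def sets.Int_stable)
    show "disjoint_family_on I UNIV"
      by (auto simp: disjoint_family_on_def I_def split: if_splits)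
  qed
  note indep = this
  have f_sub: "sigma_sets (space M) {f -` A \<inter> space M |A. A \<in> sets borel} \<subseteq>
      sigma_sets (space M) (\<Union>i\<in>I True. source w x0 i)"
  proof -
    have "{f -` A \<inter> space M |A. A \<in> sets borel} \<subseteq> sets (past w x0 k)"
      using measurable_sets[OF f] by auto
    then have "sigma_sets (space (past w x0 k)) {f -` A \<inter> space M |A. A \<in> sets borel} \<subseteq> sets (past w x0 k)"
      by (rule sets.sigma_sets_subset)
    then show ?thesis
      by (simp add: I_def sets_past)
  qed
  have w_sub: "sigma_sets (space M) {w k -` A \<inter> space M |A. A \<in> sets borel} \<subseteq>
      sigma_sets (space M) (\<Union>i\<in>I False. source w x0 i)"
    by (rule sigma_sets_mono') (auto simp: I_def source_def intro: in_vimage_algebra)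
  have "indep_set (sigma_sets (space M) {f -` A \<inter> space M |A. A \<in> sets borel})
      (sigma_sets (space M) {w k -` A \<inter> space M |A. A \<in> sets borel})"
    unfolding indep_set_def
    by (rule indep_sets_mono_sets[OF indep]) (use f_sub w_sub in \<open>auto split: bool.split\<close>)
  then show ?thesis
    using measurable_past_M[OF f] w by (simp add: indep_var_eq)
qed

end

end

section \<open>Square roots of positive semidefinite matrices\<close>

definition outer :: "real^'n \<Rightarrow> real^'n^'n" where
  "outer e = (\<chi> i j. e $ i * e $ j)"

lemma outer_mult: "outer e *v x = (e \<bullet> x) *\<^sub>R e"
  by (simp add: outer_def matrix_vector_mult_def inner_vec_def vec_eq_iff sum_distrib_left algebra_simps)

lemma qf_outer: "qf (outer e) x = (e \<bullet> x)\<^sup>2"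
  by (simp add: qf_def outer_mult power2_eq_square inner_commute)

lemma transpose_outer: "transpose (outer e) = outer e"
  by (simp add: transpose_def outer_def vec_eq_iff mult.commute)

text \<open>The first-order condition at a maximum, without derivatives.\<close>

lemma linear_le_quadratic_imp_zero:
  fixes b c :: real
  assumes "\<And>t. 2 * t * b \<le> t\<^sup>2 * c"
  shows "b = 0"
proof (rule ccontr)
  assume "b \<noteq> 0"
  \<comment> \<open>For this \<open>t\<close> the right-hand side is at most \<open>t * b\<close>,
    whereas the left-hand side is \<open>2 * (t * b)\<close> with \<open>t * b > 0\<close>.\<close>
  define t where "t = b / (\<bar>c\<bar> + 1)"
  have "t\<^sup>2 * c \<le> t\<^sup>2 * (\<bar>c\<bar> + 1)"
    by (intro mult_left_mono) auto
  then have "2 * t * b \<le> t\<^sup>2 * (\<bar>c\<bar> + 1)"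
    using assms[of t] by linarith
  also have "\<dots> = t * b"
    by (simp add: t_def power2_eq_square)
  finally have "t * b \<le> 0"
    by linarith
  moreover have "0 < t * b"
    using \<open>b \<noteq> 0\<close> by (simp add: t_def zero_less_divide_iff zero_less_mult_iff) linarith
  ultimately show False
    by simp
qed

text \<open>A maximizer of the Rayleigh quotient on the unit sphere of an invariant subspace is an
  eigenvector; split it off and induct on the dimension.\<close>

lemma psd_sqrt_on_subspace:
  fixes S :: "real^'n^'n"
  assumes S: "pos_semidef S"
    and "subspace V" "\<And>v. v \<in> V \<Longrightarrow> S *v v \<in> V"
  shows "\<exists>T. pos_semidef T \<and> (\<forall>v. (\<forall>u\<in>V. v \<bullet> u = 0) \<longrightarrow> T *v v = 0) \<and> (\<forall>v\<in>V. T *v (T *v v) = S *v v)"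
  using assms(2,3)
proof (induction "dim V" arbitrary: V rule: less_induct)
  case less
  have symS: "transpose S = S" and posS: "0 \<le> qf S x" for x
    using S by (auto simp: pos_semidef_iff)
  show ?case
  proof (cases "V \<subseteq> {0}")
    case True
    then show ?thesis
      by (intro exI[of _ 0]) (auto simp: pos_semidef_iff)
  next
    case False
    then obtain v0 where v0: "v0 \<in> V" "v0 \<noteq> 0"
      by auto
    let ?K = "V \<inter> sphere 0 1"
    have "compact ?K"
      by (simp add: closed_Int_compact closed_subspace less.prems(1))
    moreover have "inverse (norm v0) *\<^sub>R v0 \<in> ?K"
      using v0 less.prems(1) by (simp add: subspace_scale)
    moreover have "continuous_on ?K (qf S)"
      unfolding continuous_on_def by (auto intro!: tendsto_intros)
    ultimately obtain e where e: "e \<in> ?K" "\<And>y. y \<in> ?K \<Longrightarrow> qf S y \<le> qf S e"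
      using continuous_attains_sup[of ?K "qf S"] by blast
    have eV: "e \<in> V" and ee: "e \<bullet> e = 1"
      using e(1) by (auto simp: dot_square_norm)
    define l where "l = qf S e"
    have l0: "0 \<le> l"
      by (simp add: l_def posS)
    have ray: "qf S v \<le> l * (v \<bullet> v)" if "v \<in> V" for v
    proof (cases "v = 0")
      case False
      have "qf S (inverse (norm v) *\<^sub>R v) \<le> l"
        unfolding l_def using False that less.prems(1) by (intro e(2)) (simp add: subspace_scale)
      then show ?thesis
        using False by (simp add: qf_scale_vec dot_square_norm power2_eq_square field_simps)
    qed simp
    \<comment> \<open>The Rayleigh bound at \<open>e + t *\<^sub>R v\<close> has
      \<open>2 * t * (v \<bullet> (S *v e))\<close> as its first-order term.\<close>
    have orth: "v \<bullet> (S *v e) = 0" if "v \<in> V" "v \<bullet> e = 0" for v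
    proof (rule linear_le_quadratic_imp_zero)
      fix t
      have "e + t *\<^sub>R v \<in> V"
        using that eV less.prems(1) by (simp add: subspace_add subspace_scale)
      from ray[OF this] show "2 * t * (v \<bullet> (S *v e)) \<le> t\<^sup>2 * (l * (v \<bullet> v) - qf S v)"
        using that(2) ee inner_commute[of e v]
        by (simp add: qf_add_vec[OF symS] qf_scale_vec l_def[symmetric] inner_add_left inner_add_right
            algebra_simps power2_eq_square)
    qed
    have Se: "S *v e = l *\<^sub>R e"
    proof -
      \<comment> \<open>The residual of the eigenvalue equation lies in \<open>V\<close> and is
        orthogonal to \<open>e\<close>, hence to \<open>S *v e\<close>, hence to itself.\<close>
      define r where "r = S *v e - l *\<^sub>R e"
      have "r \<in> V"
        unfolding r_def using eV less.prems by (intro subspace_diff subspace_scale) auto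
      moreover have re: "r \<bullet> e = 0"
        by (simp add: r_def inner_diff_left ee l_def qf_def inner_commute[of "S *v e" e])
      ultimately have "r \<bullet> (S *v e) = 0"
        by (rule orth)
      then have "r \<bullet> r = 0"
        using re unfolding r_def inner_diff_right by simp
      then show ?thesis
        by (simp add: r_def)
    qed
    define V' where "V' = V \<inter> {v. e \<bullet> v = 0}"
    have subV': "subspace V'"
      unfolding V'_def by (intro subspace_inter less.prems(1) subspace_hyperplane)
    have "e \<notin> V'"
      by (simp add: V'_def ee)
    then have "V' \<subset> V"
      using eV unfolding V'_def by blast
    then have dim: "dim V' < dim V"
      using subV' less.prems(1) by (intro dim_psubset) (simp add: span_eq_iff[THEN iffD2])
    have inv: "S *v v \<in> V'" if "v \<in> V'" for v
      using that less.prems(2) inner_symmetric[OF symS, of e v] by (simp add: V'_def Se inner_commute)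
    obtain T where T: "pos_semidef T" "\<And>v. (\<forall>u\<in>V'. v \<bullet> u = 0) \<Longrightarrow> T *v v = 0"
      "\<And>v. v \<in> V' \<Longrightarrow> T *v (T *v v) = S *v v"
      using less.hyps[OF dim subV' inv] by blast
    have symT: "transpose T = T" and posT: "0 \<le> qf T x" for x
      using T(1) by (auto simp: pos_semidef_iff)
    \<comment> \<open>The induction carries the clause on the orthogonal complement for this:
      \<open>T\<close> and \<open>outer e\<close> annihilate each other, so the square of
      \<open>T'\<close> has no mixed terms.\<close>
    have Te: "T *v e = 0"
      by (rule T(2)) (simp add: V'_def)
    have eT: "e \<bullet> (T *v v) = 0" for v
      using inner_symmetric[OF symT, of e v] by (simp add: Te)
    define T' where "T' = T + sqrt l *\<^sub>R outer e"
    have T'v: "T' *v v = T *v v + (sqrt l * (e \<bullet> v)) *\<^sub>R e" for v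
      by (simp add: T'_def matrix_vector_mult_add_rdistrib scaleR_matrix_vector_assoc[symmetric] outer_mult)
    have "pos_semidef T'"
      using l0 posT
      by (simp add: pos_semidef_iff T'_def transpose_add transpose_scalar transpose_outer symT qf_add qf_scaleR qf_outer)
    moreover have "T' *v v = 0" if "\<forall>u\<in>V. v \<bullet> u = 0" for v
      using that T(2)[of v] eV by (auto simp: T'v V'_def inner_commute)
    moreover have "T' *v (T' *v v) = S *v v" if "v \<in> V" for v
    proof -
      define c v' where "c = e \<bullet> v" and "v' = v - c *\<^sub>R e"
      have v: "v = v' + c *\<^sub>R e"
        by (simp add: v'_def)
      have v': "v' \<in> V'"
        using that eV less.prems(1) ee
        by (simp add: V'_def v'_def c_def subspace_diff subspace_scale inner_diff_right)
      have Tv: "T *v v = T *v v'"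
        by (subst v) (simp add: matrix_vector_right_distrib matrix_vector_mult_scaleR Te)
      have "T' *v (T' *v v) = T *v (T *v v') + (sqrt l * sqrt l * c) *\<^sub>R e"
        by (simp add: T'v matrix_vector_right_distrib matrix_vector_mult_scaleR Te inner_add_right eT ee Tv c_def[symmetric])
      also have "\<dots> = S *v v' + (l * c) *\<^sub>R e"
        using l0 by (simp add: T(3)[OF v'])
      also have "\<dots> = S *v v"
        by (subst v) (simp add: matrix_vector_right_distrib matrix_vector_mult_scaleR Se mult.commute)
      finally show ?thesis .
    qed
    ultimately show ?thesis
      by blast
  qed
qed

text \<open>The subspace lemma on the whole space supplies the existence that the choice in
  \<open>psd_sqrt\<close> relies on.\<close>

lemma psd_sqrt:
  assumes "pos_semidef S"
  shows "transpose (psd_sqrt S) = psd_sqrt S" "psd_sqrt S ** psd_sqrt S = S"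
proof -
  obtain T where "pos_semidef T" "\<forall>v\<in>UNIV. T *v (T *v v) = S *v v"
    using psd_sqrt_on_subspace[OF assms, of UNIV] by auto
  then have "\<exists>T. pos_semidef T \<and> T ** T = S"
    by (intro exI[of _ T]) (simp add: matrix_eq matrix_vector_mul_assoc)
  from someI_ex[OF this] show "transpose (psd_sqrt S) = psd_sqrt S" "psd_sqrt S ** psd_sqrt S = S"
    by (auto simp: psd_sqrt_def pos_semidef_def)
qed

section \<open>Block matrices and the energy of the output\<close>

lemma sum_UNIV_sum:
  "(\<Sum>i\<in>(UNIV :: ('a::finite + 'b::finite) set). f i) = (\<Sum>i\<in>UNIV. f (Inl i)) + (\<Sum>i\<in>UNIV. (f (Inr i) :: real))"
  by (subst UNIV_Plus_UNIV[symmetric], subst sum.Plus) simp_all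

lemma block_diag_stack: "block_diag S T *v stack x y = stack (S *v x) (T *v y)"
proof -
  have "(block_diag S T *v stack x y) $ i = stack (S *v x) (T *v y) $ i" for i
    by (cases i) (simp_all add: block_diag_def stack_def matrix_vector_mult_def sum_UNIV_sum)
  then show ?thesis
    by (simp add: vec_eq_iff)
qed

lemma inner_stack: "stack x y \<bullet> stack x' y' = x \<bullet> x' + y \<bullet> y'"
  by (simp add: stack_def inner_vec_def sum_UNIV_sum)

lemma qf_block_diag: "qf (block_diag S T) (stack x y) = qf S x + qf T y"
  by (simp add: qf_def block_diag_stack inner_stack)

lemma pos_semidef_block_diag:
  assumes "pos_semidef S" "pos_semidef T"
  shows "pos_semidef (block_diag S T)"
proof -
  have entry: "S $ i $ j = S $ j $ i" "T $ k $ l = T $ l $ k" for i j k l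
  proof -
    have "transpose S $ j $ i = S $ j $ i" "transpose T $ l $ k = T $ l $ k"
      using assms by (simp_all only: pos_semidef_def)
    then show "S $ i $ j = S $ j $ i" "T $ k $ l = T $ l $ k"
      by (simp_all add: transpose_def)
  qed
  have "block_diag S T $ i $ j = block_diag S T $ j $ i" for i j
    by (cases i; cases j) (simp_all add: block_diag_def entry)
  then have "transpose (block_diag S T) = block_diag S T"
    by (simp add: transpose_def vec_eq_iff)
  moreover have "0 \<le> qf (block_diag S T) z" for z
  proof -
    have "z $ i = stack (\<chi> k. z $ Inl k) (\<chi> k. z $ Inr k) $ i" for i
      by (cases i) (simp_all add: stack_def)
    then have "z = stack (\<chi> k. z $ Inl k) (\<chi> k. z $ Inr k)"
      by (rule vec_eq_iff[THEN iffD2, OF allI])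
    then obtain x y where "z = stack x y"
      by blast
    then show ?thesis
      using assms by (simp add: qf_block_diag pos_semidef_iff)
  qed
  ultimately show ?thesis
    by (simp add: pos_semidef_iff)
qed

text \<open>The root is symmetric, so the squared length of the output involves only its square, the
  block matrix.\<close>

lemma output_energy:
  assumes "pos_semidef S" "pos_semidef T"
  shows "(psd_sqrt (block_diag S T) *v stack x y) \<bullet> (psd_sqrt (block_diag S T) *v stack x y) = qf S x + qf T y"
proof -
  note root = psd_sqrt[OF pos_semidef_block_diag[OF assms]]
  have "qf (block_diag S T) (stack x y) = qf (psd_sqrt (block_diag S T) ** mat 1 ** psd_sqrt (block_diag S T)) (stack x y)"
    by (simp add: root(2))
  also have "\<dots> = qf (mat 1) (psd_sqrt (block_diag S T) *v stack x y)"
    using qf_congruence[of "psd_sqrt (block_diag S T)" "mat 1"] by (simp only: root(1))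
  finally show ?thesis
    by (simp add: qf_block_diag)
qed

section \<open>The closed loop\<close>

locale mean_field =
  coupled_riccati A Ab C Cb Q Qb B Bb D Db R Rb \<sigma> + prob_space M
  for A Ab C Cb Q Qb :: "real^'n^'n"
    and B Bb D Db :: "real^'m^'n"
    and R Rb :: "real^'m^'m" and \<sigma> :: real
    and M :: "'s measure" +
  fixes w :: "nat \<Rightarrow> 's \<Rightarrow> real"
  assumes noise: "white_noise M w \<sigma>"
begin

lemma noise_facts:
  shows noise_measurable: "w k \<in> borel_measurable M"
    and noise_sq_integrable: "integrable M (\<lambda>\<omega>. (w k \<omega>)\<^sup>2)"
    and noise_integrable: "integrable M (w k)"
    and noise_mean: "expectation (w k) = 0"
    and noise_variance: "expectation (\<lambda>\<omega>. (w k \<omega>)\<^sup>2) = \<sigma>\<^sup>2"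
proof -
  show meas: "w k \<in> borel_measurable M" and sq: "integrable M (\<lambda>\<omega>. (w k \<omega>)\<^sup>2)"
    and mean: "expectation (w k) = 0"
    using noise by (auto simp: white_noise_def)
  show "integrable M (w k)"
    by (rule square_integrable_imp_integrable[OF meas sq])
  show "expectation (\<lambda>\<omega>. (w k \<omega>)\<^sup>2) = \<sigma>\<^sup>2"
  proof -
    have "variance (w k) = \<sigma>\<^sup>2"
      using noise unfolding white_noise_def by blast
    then show ?thesis
      by (simp add: mean)
  qed
qed

lemma expectation_feedback:
  "sqint M x \<Longrightarrow> expectation (feedback M L Lb x) = (L + Lb) *v expectation x"
  unfolding feedback_def
  by (simp add: expectation_matrix sqint_integrable[OF sqint_matrix] prob_space matrix_vector_mult_add_rdistrib)

text \<open>The control has fluctuation \<open>L\<close> times that of the state and mean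
  \<open>(L + Lb) *v expectation x\<close>, and the two do not mix in a quadratic cost. Hence the
  second gain is \<open>L + Lb\<close>.\<close>

lemma stage_cost_eq:
  assumes x: "sqint M x"
  shows "expectation (\<lambda>\<omega>. x \<omega> \<bullet> (Q *v x \<omega>) + expectation x \<bullet> (Qb *v expectation x) +
      feedback M L Lb x \<omega> \<bullet> (R *v feedback M L Lb x \<omega>) +
      expectation (feedback M L Lb x) \<bullet> (Rb *v expectation (feedback M L Lb x))) =
    val (cl_cost L (L + Lb)) x"
proof -
  define m where "m = expectation x"
  have sq: "sqint M (\<lambda>\<omega>. L *v x \<omega> + Lb *v m)" "sqint M (\<lambda>\<omega>. x \<omega> - m)"
    using x by auto
  have "expectation (\<lambda>\<omega>. qf R (L *v x \<omega> + Lb *v m)) =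
      expectation (\<lambda>\<omega>. qf R (L *v (x \<omega> - m))) + qf R ((L + Lb) *v m)"
    using second_moment[OF x symmetric_data(1), of L "Lb *v m"]
    by (simp add: m_def matrix_vector_mult_add_rdistrib)
  moreover have "expectation (\<lambda>\<omega>. qf Q (x \<omega>)) = expectation (\<lambda>\<omega>. qf Q (x \<omega> - m)) + qf Q m"
    using second_moment[OF x symmetric_data(3), of "mat 1" 0] by (simp add: m_def)
  moreover have "val (cl_cost L (L + Lb)) x =
      expectation (\<lambda>\<omega>. qf Q (x \<omega> - m)) + expectation (\<lambda>\<omega>. qf R (L *v (x \<omega> - m)))
      + qf (Q + Qb) m + qf (R + Rb) ((L + Lb) *v m)"
    unfolding val_def m_def[symmetric] cl_cost_def fst_conv snd_conv qf_add[of _ "_ ** _"] qf_congruence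
    using sqint_integrable_qf[OF sq(2), of Q]
      sqint_integrable_qf[OF sqint_matrix[OF sq(2), of L], of R] by simp
  ultimately show ?thesis
    unfolding expectation_feedback[OF x] qf_def[symmetric] m_def[symmetric]
    unfolding feedback_def m_def[symmetric]
    using sqint_integrable_qf[OF x, of Q] sqint_integrable_qf[OF sq(1), of R]
    by (simp add: prob_space qf_add)
qed

section \<open>One step of the closed loop in second moments\<close>

context
  fixes x0 :: "'s \<Rightarrow> real^'n"
  assumes x0: "initial_state M w x0"
begin

text \<open>\<open>f\<close> is determined by the past, so its products with powers of
  \<open>w k\<close> factor under the expectation.\<close>

lemma
  fixes f :: "'s \<Rightarrow> real"
  assumes f: "f \<in> borel_measurable (past w x0 k)" "integrable M f"
  shows integrable_mult_noise: "integrable M (\<lambda>\<omega>. f \<omega> * w k \<omega>)"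
    and expectation_mult_noise: "expectation (\<lambda>\<omega>. f \<omega> * w k \<omega>) = 0"
    and integrable_mult_noise_sq: "integrable M (\<lambda>\<omega>. f \<omega> * (w k \<omega>)\<^sup>2)"
    and expectation_mult_noise_sq: "expectation (\<lambda>\<omega>. f \<omega> * (w k \<omega>)\<^sup>2) = \<sigma>\<^sup>2 * expectation f"
proof -
  have ind: "indep_var borel f borel (w k)"
    by (rule indep_past_noise[OF x0 f(1) noise_measurable])
  then have ind2: "indep_var borel f borel (\<lambda>\<omega>. (w k \<omega>)\<^sup>2)"
    using indep_var_compose[OF ind, of id borel "\<lambda>t. t\<^sup>2" borel] by (simp add: comp_def id_def)
  show "integrable M (\<lambda>\<omega>. f \<omega> * w k \<omega>)" "integrable M (\<lambda>\<omega>. f \<omega> * (w k \<omega>)\<^sup>2)"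
    using indep_var_integrable[OF ind f(2) noise_integrable]
      indep_var_integrable[OF ind2 f(2) noise_sq_integrable] by auto
  show "expectation (\<lambda>\<omega>. f \<omega> * w k \<omega>) = 0"
    using indep_var_lebesgue_integral[OF ind f(2) noise_integrable] by (simp add: noise_mean)
  show "expectation (\<lambda>\<omega>. f \<omega> * (w k \<omega>)\<^sup>2) = \<sigma>\<^sup>2 * expectation f"
    using indep_var_lebesgue_integral[OF ind2 f(2) noise_sq_integrable] by (simp add: noise_variance)
qed

lemma sqint_initial: "sqint M x0"
  using x0 by (simp add: initial_state_def sqint_def)

text \<open>The new fluctuation is \<open>F *v (x \<omega> - m) + w k \<omega> *\<^sub>R \<beta>
  \<omega>\<close> with \<open>\<beta>\<close> determined by the past, so the mixed term has mean 0
  and the square brings the factor \<open>\<sigma>\<^sup>2\<close>. As \<open>\<beta>\<close>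
  contains the mean, \<open>fst X\<close> also weighs the mean.\<close>

lemma
  fixes x :: "'s \<Rightarrow> real^'n" and L Lb :: "real^'n^'m"
  assumes x: "x \<in> borel_measurable (past w x0 k)" "sqint M x"
  defines "x' \<equiv> mf_step M A Ab B Bb C Cb D Db (w k) x (feedback M L Lb x)"
  shows mf_step_measurable: "x' \<in> borel_measurable (past w x0 (Suc k))"
    and mf_step_sqint: "sqint M x'"
    and mf_step_val: "sym_pair X \<Longrightarrow> val X x' = val (cl_op L (L + Lb) X) x"
proof -
  define m where "m = expectation x"
  \<comment> \<open>\<open>c\<close> and \<open>d\<close> collect the contributions that see
    \<open>x\<close> only through its mean and are constant in the sample.\<close>
  define F G c d where "F = A + B ** L" and "G = C + D ** L"
    and "c = Ab *v m + B *v (Lb *v m) + Bb *v ((L + Lb) *v m)"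
    and "d = Cb *v m + D *v (Lb *v m) + Db *v ((L + Lb) *v m)"
  define \<beta> where "\<beta> \<omega> = G *v x \<omega> + d" for \<omega>
  have x': "x' = (\<lambda>\<omega>. (F *v x \<omega> + c) + w k \<omega> *\<^sub>R \<beta> \<omega>)"
    unfolding x'_def mf_step_def expectation_feedback[OF x(2)]
    unfolding feedback_def m_def[symmetric] \<beta>_def
      F_def G_def c_def d_def
    by (simp add: matrix_vector_right_distrib matrix_vector_mult_add_rdistrib matrix_vector_mul_assoc add_ac)
  have \<beta>: "\<beta> \<in> borel_measurable (past w x0 k)" "sqint M \<beta>"
    unfolding \<beta>_def using x by (auto intro!: borel_measurable_add borel_measurable_matrix_vector)
  show "x' \<in> borel_measurable (past w x0 (Suc k))"
    unfolding x'
    by (intro borel_measurable_add borel_measurable_scaleR borel_measurable_matrix_vector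
        borel_measurable_const measurable_past_Suc x(1) \<beta>(1) measurable_past_noise lessI)
  have "integrable M (\<lambda>\<omega>. (\<beta> \<omega> \<bullet> \<beta> \<omega>) * (w k \<omega>)\<^sup>2)"
    using \<beta> by (intro integrable_mult_noise_sq) (auto simp: sqint_def)
  then have w\<beta>: "sqint M (\<lambda>\<omega>. w k \<omega> *\<^sub>R \<beta> \<omega>)"
    unfolding sqint_def using \<beta>(2) noise_measurable
    by (auto simp: sqint_def power2_eq_square algebra_simps)
  \<comment> \<open>Pairing the expectation with itself reduces the vector claim to the scalar
    moment formula.\<close>
  have Ew\<beta>: "expectation (\<lambda>\<omega>. w k \<omega> *\<^sub>R \<beta> \<omega>) = 0"
  proof -
    define b where "b = expectation (\<lambda>\<omega>. w k \<omega> *\<^sub>R \<beta> \<omega>)"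
    have "b \<bullet> b = expectation (\<lambda>\<omega>. (\<beta> \<omega> \<bullet> b) * w k \<omega>)"
      using integral_inner_left[OF sqint_integrable[OF w\<beta>], of b] by (simp add: b_def mult.commute)
    also have "\<dots> = 0"
      using \<beta> by (intro expectation_mult_noise) (auto intro: sqint_integrable_inner)
    finally show ?thesis
      by (simp add: b_def)
  qed
  have sqF: "sqint M (\<lambda>\<omega>. F *v x \<omega> + c)"
    using x(2) by auto
  then show "sqint M x'"
    unfolding x' using w\<beta> by auto
  have Ex': "expectation x' = F *v m + c"
    unfolding x' using x(2) w\<beta> sqF
    by (simp add: sqint_integrable Ew\<beta> expectation_matrix sqint_matrix prob_space m_def)
  show "val X x' = val (cl_op L (L + Lb) X) x" if "sym_pair X"
  proof -
    define P where "P = fst X"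
    have P: "transpose P = P"
      using that by (simp add: P_def sym_pair_def)
    define y where "y \<omega> = F *v (x \<omega> - m)" for \<omega>
    have y: "y \<in> borel_measurable (past w x0 k)" "sqint M y"
      unfolding y_def
      by (intro borel_measurable_matrix_vector borel_measurable_diff borel_measurable_const x(1))
        (intro sqint_matrix sqint_diff sqint_const x(2))
    have split: "qf P (x' \<omega> - expectation x') =
        qf P (y \<omega>) + 2 * ((\<beta> \<omega> \<bullet> (P *v y \<omega>)) * w k \<omega>) + qf P (\<beta> \<omega>) * (w k \<omega>)\<^sup>2" for \<omega>
    proof -
      have "x' \<omega> - expectation x' = y \<omega> + w k \<omega> *\<^sub>R \<beta> \<omega>"
        unfolding Ex' by (simp add: x' y_def matrix_vector_mult_diff_distrib)
      then show ?thesis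
        by (simp add: qf_add_vec[OF P] qf_scale_vec mult_ac)
    qed
    have cross: "(\<lambda>\<omega>. \<beta> \<omega> \<bullet> (P *v y \<omega>)) \<in> borel_measurable (past w x0 k)"
      "integrable M (\<lambda>\<omega>. \<beta> \<omega> \<bullet> (P *v y \<omega>))"
      using \<beta> y by (auto intro!: borel_measurable_inner borel_measurable_matrix_vector sqint_integrable_inner)
    have sq: "(\<lambda>\<omega>. qf P (\<beta> \<omega>)) \<in> borel_measurable (past w x0 k)" "integrable M (\<lambda>\<omega>. qf P (\<beta> \<omega>))"
      using \<beta> by (auto intro!: borel_measurable_qf)
    have "expectation (\<lambda>\<omega>. qf P (x' \<omega> - expectation x')) =
        expectation (\<lambda>\<omega>. qf P (y \<omega>)) + \<sigma>\<^sup>2 * expectation (\<lambda>\<omega>. qf P (\<beta> \<omega>))"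
      unfolding split
      using sqint_integrable_qf[OF y(2)] integrable_mult_noise[OF cross] integrable_mult_noise_sq[OF sq]
      by (simp add: expectation_mult_noise[OF cross] expectation_mult_noise_sq[OF sq])
    moreover have "expectation (\<lambda>\<omega>. qf P (\<beta> \<omega>)) =
        expectation (\<lambda>\<omega>. qf P (G *v (x \<omega> - m))) + qf P (G *v m + d)"
      unfolding \<beta>_def m_def by (rule second_moment[OF x(2) P])
    moreover have "val (cl_op L (L + Lb) X) x =
        expectation (\<lambda>\<omega>. qf P (y \<omega>) + \<sigma>\<^sup>2 * qf P (G *v (x \<omega> - m)))
        + qf (snd X) (F *v m + c) + \<sigma>\<^sup>2 * qf P (G *v m + d)"
      unfolding val_def m_def[symmetric] cl_op_def fst_conv snd_conv qf_lyap stage_def P_def y_def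
      by (simp add: F_def G_def c_def d_def matrix_vector_right_distrib matrix_vector_mult_add_rdistrib
          matrix_vector_mul_assoc matrix_add_rdistrib_mult add_ac)
    moreover have "expectation (\<lambda>\<omega>. qf P (y \<omega>) + \<sigma>\<^sup>2 * qf P (G *v (x \<omega> - m))) =
        expectation (\<lambda>\<omega>. qf P (y \<omega>)) + \<sigma>\<^sup>2 * expectation (\<lambda>\<omega>. qf P (G *v (x \<omega> - m)))"
      using sqint_integrable_qf[OF y(2), of P]
        sqint_integrable_qf[OF sqint_matrix[OF sqint_diff[OF x(2) sqint_const]], of P G m]
      by simp
    ultimately show ?thesis
      by (simp add: val_def Ex' P_def[symmetric] algebra_simps)
  qed
qed

abbreviation "state \<equiv> closed_loop M w A Ab B Bb C Cb D Db"

lemma state_past: "state L Lb x0 k \<in> borel_measurable (past w x0 k) \<and> sqint M (state L Lb x0 k)"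
  by (induction k)
     (auto intro: measurable_past_initial sqint_initial mf_step_measurable mf_step_sqint)

lemmas state_measurable = state_past[THEN conjunct1]
  and state_sqint = state_past[THEN conjunct2]

lemma val_state_Suc:
  "sym_pair X \<Longrightarrow> val X (state L Lb x0 (Suc k)) = val (cl_op (L k) (L k + Lb k) X) (state L Lb x0 k)"
  using mf_step_val[OF state_measurable state_sqint] by simp

text \<open>Duality: moving the state forward equals pulling the form back. The last step is moved
  to the form first, so the induction needs arbitrary \<open>X\<close>.\<close>

lemma val_state:
  "sym_pair X \<Longrightarrow> val X (state (\<lambda>_. L) (\<lambda>_. Lb) x0 k) = val ((cl_op L (L + Lb) ^^ k) X) x0"
proof (induction k arbitrary: X)
  case (Suc k)
  have "sym_pair (cl_op L (L + Lb) X)"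
    using positive_operator.symmetric[OF positive_operator_cl_op Suc.prems] .
  from Suc.IH[OF this] show ?case
    by (simp only: val_state_Suc[OF Suc.prems] funpow_Suc_right comp_apply)
qed simp

lemma control_information:
  "control M w A Ab B Bb C Cb D Db L Lb x0 k \<in> borel_measurable (information M w x0 k)"
  unfolding control_def feedback_def
  by (intro measurable_past_information borel_measurable_add borel_measurable_matrix_vector
      borel_measurable_const state_measurable)

lemma cost_eq:
  "cost M w A Ab B Bb C Cb D Db Q Qb R Rb L Lb x0 =
    (\<Sum>k. ereal (val (cl_cost (L k) (L k + Lb k)) (state L Lb x0 k)))"
  unfolding cost_def Let_def control_def stage_cost_eq[OF state_sqint] ..

end

end

section \<open>Test states\<close>

context prob_space
begin

text \<open>A function of \<open>x0\<close> generates a smaller sigma-algebra and inherits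
  independence.\<close>

lemma initial_state_compose:
  fixes x0 x1 :: "'a \<Rightarrow> real^'n"
  assumes x0: "initial_state M w x0" and sq: "sqint M x1" and g: "g \<in> borel_measurable borel"
    and x1: "\<And>\<omega>. x1 \<omega> = g (x0 \<omega>)"
  shows "initial_state M w x1"
proof -
  have "x0 \<in> borel_measurable (vimage_algebra (space M) x0 borel)"
    by (rule measurable_vimage_algebra1) simp
  then have "x1 \<in> borel_measurable (vimage_algebra (space M) x0 borel)"
    unfolding x1[abs_def] using g by (rule measurable_compose)
  then have "sets (vimage_algebra (space M) x1 borel) \<subseteq> sets (vimage_algebra (space M) x0 borel)"
    by (intro sets_image_in_sets) auto
  then have "indep_sets (source w x1) UNIV"
    by (intro indep_sets_mono_sets[OF indep_sources[OF x0]]) (auto simp: source_def split: option.splits)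
  then show ?thesis
    using sq by (simp add: initial_state_def sqint_def source_def[abs_def])
qed

end

text \<open>A normalized centred coordinate \<open>\<zeta>\<close> of a genuinely random initial state turns every pair
  \<open>(a, m)\<close> of vectors into the initial state \<open>\<zeta> a + m\<close>.\<close>

lemma (in prob_space) test_states:
  fixes x0 :: "'a \<Rightarrow> real^'n"
  assumes x0: "initial_state M w x0" and rnd: "\<not> zero_vec M (\<lambda>\<omega>. x0 \<omega> - expectation x0)"
  obtains \<xi> :: "(real^'n) \<times> (real^'n) \<Rightarrow> 'a \<Rightarrow> real^'n"
  where "\<And>z. initial_state M w (\<xi> z)"
    and "\<And>X z. val X (\<xi> z) = qp X z"
proof -
  have sq0: "sqint M x0"
    using x0 by (simp add: initial_state_def sqint_def)
  define y where "y \<omega> = x0 \<omega> - expectation x0" for \<omega>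
  have y: "sqint M y" "expectation y = 0"
    using sq0 expectation_centered[OF sq0] by (auto simp: y_def[abs_def])
  \<comment> \<open>The product is a rank-one matrix applied to \<open>y\<close>, which brings
    \<open>sqint_matrix\<close> to bear.\<close>
  have sqy: "sqint M (\<lambda>\<omega>. (y \<omega> $ i) *\<^sub>R a)" for i a
  proof -
    have "sqint M (\<lambda>\<omega>. (\<chi> k j. if j = i then a $ k else 0) *v y \<omega>)"
      by (rule sqint_matrix[OF y(1)])
    moreover have "(\<chi> k j. if j = i then a $ k else 0) *v v = (v $ i) *\<^sub>R a" for v :: "real^'n"
      by (simp add: matrix_vector_mult_def vec_eq_iff if_distrib if_distribR mult.commute cong: if_cong)
    ultimately show ?thesis
      by simp
  qed
  have comp: "integrable M (\<lambda>\<omega>. (y \<omega> $ i)\<^sup>2)" "expectation (\<lambda>\<omega>. y \<omega> $ i) = 0"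
    "integrable M (\<lambda>\<omega>. y \<omega> $ i)" for i
  proof -
    show "integrable M (\<lambda>\<omega>. y \<omega> $ i)"
      using sqint_integrable_inner[OF y(1) sqint_const, of "axis i 1"] by (simp add: inner_axis)
    show "integrable M (\<lambda>\<omega>. (y \<omega> $ i)\<^sup>2)"
      using sqy[of i "axis i 1"] by (simp add: sqint_def inner_axis_axis power2_eq_square)
    have "expectation (\<lambda>\<omega>. y \<omega> \<bullet> axis i 1) = expectation y \<bullet> axis i 1"
      by (intro integral_inner_left sqint_integrable y(1))
    then show "expectation (\<lambda>\<omega>. y \<omega> $ i) = 0"
      by (simp add: y(2) inner_axis)
  qed
  have "expectation (\<lambda>\<omega>. y \<omega> \<bullet> y \<omega>) = (\<Sum>i\<in>UNIV. expectation (\<lambda>\<omega>. (y \<omega> $ i)\<^sup>2))"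
    unfolding inner_vec_def inner_real_def power2_eq_square[symmetric]
    by (rule Bochner_Integration.integral_sum) (rule comp(1))
  moreover have "expectation (\<lambda>\<omega>. y \<omega> \<bullet> y \<omega>) \<noteq> 0"
    using rnd by (simp add: zero_vec_def y_def)
  \<comment> \<open>The total variance is the sum of the coordinate variances, so one of them is
    nonzero.\<close>
  ultimately obtain i where i: "expectation (\<lambda>\<omega>. (y \<omega> $ i)\<^sup>2) \<noteq> 0"
    by (metis (no_types, lifting) sum.neutral)
  define s where "s = sqrt (expectation (\<lambda>\<omega>. (y \<omega> $ i)\<^sup>2))"
  have "0 \<le> expectation (\<lambda>\<omega>. (y \<omega> $ i)\<^sup>2)"
    by simp
  then have s: "s \<noteq> 0" "s\<^sup>2 = expectation (\<lambda>\<omega>. (y \<omega> $ i)\<^sup>2)"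
    using i by (auto simp: s_def)
  \<comment> \<open>Division by \<open>s\<close> makes the random factor of \<open>fst z\<close>
    centred with variance 1; \<open>val\<close> then collapses to \<open>qp\<close>.\<close>
  define \<xi> where "\<xi> z \<omega> = (y \<omega> $ i) *\<^sub>R (inverse s *\<^sub>R fst z) + snd z" for z :: "(real^'n) \<times> (real^'n)" and \<omega>
  have sq\<xi>: "sqint M (\<xi> z)" for z
    unfolding \<xi>_def by (intro sqint_add sqy sqint_const)
  have E\<xi>: "expectation (\<xi> z) = snd z" for z
  proof -
    have "expectation (\<lambda>\<omega>. (y \<omega> $ i) *\<^sub>R (inverse s *\<^sub>R fst z)) = 0"
      using comp(2)[of i] by (subst integral_scaleR_left) (auto intro: comp(3))
    then show ?thesis
      unfolding \<xi>_def using sqint_integrable[OF sqy, of i "inverse s *\<^sub>R fst z"]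
      by (simp add: prob_space del: scaleR_scaleR)
  qed
  have "val X (\<xi> z) = qp X z" for X z
  proof -
    have "expectation (\<lambda>\<omega>. qf (fst X) (\<xi> z \<omega> - snd z)) = expectation (\<lambda>\<omega>. (y \<omega> $ i)\<^sup>2) * (inverse s)\<^sup>2 * qf (fst X) (fst z)"
      by (simp add: \<xi>_def qf_scale_vec power_mult_distrib comp(1))
    also have "\<dots> = qf (fst X) (fst z)"
      using s(1) by (simp add: s(2)[symmetric] power_inverse)
    finally show ?thesis
      by (simp add: val_def E\<xi> qp_def)
  qed
  moreover have "initial_state M w (\<xi> z)" for z
  proof (rule initial_state_compose[OF x0 sq\<xi>])
    show "(\<lambda>v. ((v - expectation x0) $ i) *\<^sub>R (inverse s *\<^sub>R fst z) + snd z) \<in> borel_measurable borel"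
      by (intro borel_measurable_continuous_onI continuous_intros)
    show "\<xi> z \<omega> = ((x0 \<omega> - expectation x0) $ i) *\<^sub>R (inverse s *\<^sub>R fst z) + snd z" for \<omega>
      by (simp only: \<xi>_def y_def)
  qed
  ultimately show ?thesis
    using that[of \<xi>] by blast
qed

section \<open>Observability and stabilization\<close>

locale observable_mean_field =
  mean_field A Ab C Cb Q Qb B Bb D Db R Rb \<sigma> M w
  for A Ab C Cb Q Qb :: "real^'n^'n"
    and B Bb D Db :: "real^'m^'n"
    and R Rb :: "real^'m^'m" and \<sigma> :: real
    and M :: "'s measure" and w :: "nat \<Rightarrow> 's \<Rightarrow> real" +
  assumes random_initial: "\<exists>x0 :: 's \<Rightarrow> real^'n. initial_state M w x0 \<and>
      \<not> zero_vec M (\<lambda>\<omega>. x0 \<omega> - expectation x0)"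
    and observable: "exactly_observable M w A Ab C Cb (psd_sqrt (block_diag Q (Q + Qb)))"
begin

lemma test_states_exist:
  obtains \<xi> :: "(real^'n) \<times> (real^'n) \<Rightarrow> 's \<Rightarrow> real^'n"
  where "\<And>z. initial_state M w (\<xi> z)" and "\<And>X z. val X (\<xi> z) = qp X z"
  using random_initial test_states[where w = w] by metis

text \<open>The cost is a sum of four nonnegative terms; definiteness of \<open>R\<close> and
  \<open>R + Rb\<close> turns zero control cost into zero control, for the fluctuation almost
  everywhere.\<close>

lemma zero_cost_imp_output_zero:
  assumes x: "sqint M x" and zero: "val (cl_cost L Lm) x = 0"
  shows "AE \<omega> in M. L *v (x \<omega> - expectation x) = 0" "Lm *v expectation x = 0"
    "val (Q, Q + Qb) x = 0"
proof -
  define m where "m = expectation x"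
  have y: "sqint M (\<lambda>\<omega>. x \<omega> - m)"
    using x by auto
  have psd: "0 \<le> qf Q v" "0 \<le> qf (Q + Qb) v" "0 \<le> qf R u" "0 \<le> qf (R + Rb) u" for u v
    using Q R[THEN pos_def_imp_semidef] by (simp_all only: pos_semidef_iff)
  have cost: "val (cl_cost L Lm) x = expectation (\<lambda>\<omega>. qf Q (x \<omega> - m)) + expectation (\<lambda>\<omega>. qf R (L *v (x \<omega> - m)))
      + qf (Q + Qb) m + qf (R + Rb) (Lm *v m)"
    unfolding val_def m_def[symmetric] cl_cost_def fst_conv snd_conv qf_add[of _ "_ ** _"] qf_congruence
    using sqint_integrable_qf[OF y, of Q] sqint_integrable_qf[OF sqint_matrix[OF y, of L], of R] by simp
  have nonneg: "0 \<le> expectation (\<lambda>\<omega>. qf Q (x \<omega> - m))" "0 \<le> expectation (\<lambda>\<omega>. qf R (L *v (x \<omega> - m)))"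
    by (intro integral_nonneg_AE AE_I2 psd)+
  have parts: "expectation (\<lambda>\<omega>. qf Q (x \<omega> - m)) = 0" "expectation (\<lambda>\<omega>. qf R (L *v (x \<omega> - m))) = 0"
    "qf (Q + Qb) m = 0" "qf (R + Rb) (Lm *v m) = 0"
    using zero nonneg psd(2)[of m] psd(4)[of "Lm *v m"] unfolding cost by linarith+
  have "AE \<omega> in M. qf R (L *v (x \<omega> - m)) = 0"
    using parts(2) integral_nonneg_eq_0_iff_AE[OF sqint_integrable_qf[OF sqint_matrix[OF y, of L], of R]]
    by (simp add: psd)
  then show "AE \<omega> in M. L *v (x \<omega> - expectation x) = 0"
    using R(1) by (auto simp: pos_def_iff_semidef m_def elim: eventually_mono)
  show "Lm *v expectation x = 0"
    using parts(4) R(2) by (simp add: pos_def_iff_semidef m_def)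
  show "val (Q, Q + Qb) x = 0"
    using parts(1,3) by (simp add: val_def m_def)
qed

text \<open>Start the loop at the test state of \<open>z\<close>: the hypothesis says that all its
  stage costs vanish, and its second moment is \<open>z \<bullet> z\<close>.\<close>

lemma closed_loop_observable:
  fixes L Lm :: "real^'n^'m"
  assumes zero: "\<And>k. qp ((cl_op L Lm ^^ k) (cl_cost L Lm)) z = 0"
  shows "z = 0"
proof -
  obtain \<xi> where \<xi>: "\<And>z :: (real^'n) \<times> (real^'n). initial_state M w (\<xi> z)" "\<And>X z. val X (\<xi> z) = qp X z"
    using test_states_exist by blast
  let ?x = "closed_loop M w A Ab B Bb C Cb D Db (\<lambda>_. L) (\<lambda>_. Lm - L) (\<xi> z)"
  let ?v = "uncontrolled M w A Ab C Cb (\<xi> z)"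
  have x: "sqint M (?x k)" for k
    by (rule state_sqint[OF \<xi>(1)])
  have "val (cl_cost L Lm) (?x k) = 0" for k
    using val_state[OF \<xi>(1) psd_pair_sym[OF psd_cl_cost], of L Lm L "Lm - L" z k] zero[of k]
    by (simp add: \<xi>(2))
  note out = zero_cost_imp_output_zero[OF x this]
  have meas: "?v k \<in> borel_measurable M" for k
  proof (induction k)
    case 0
    then show ?case
      using \<xi>(1)[of z] by (simp add: initial_state_def)
  next
    case (Suc k)
    then show ?case
      unfolding uncontrolled.simps Let_def
      by (intro borel_measurable_add borel_measurable_scaleR borel_measurable_matrix_vector
          borel_measurable_const noise_measurable)
  qed
  \<comment> \<open>The control vanishes only almost everywhere, so the paths agree only almost
    everywhere; this still gives equal means, which the next step needs.\<close>
  have eq: "AE \<omega> in M. ?v k \<omega> = ?x k \<omega>" for k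
  proof (induction k)
    case (Suc k)
    let ?u = "feedback M L (Lm - L) (?x k)"
    have Eu: "expectation ?u = 0"
      using expectation_feedback[OF x, of L "Lm - L" k] out(2)[of k] by simp
    have Ex: "expectation (?v k) = expectation (?x k)"
      by (rule integral_cong_AE[OF meas _ Suc]) (use x in \<open>simp add: sqint_def\<close>)
    show ?case
      using Suc out(1)[of k]
    proof eventually_elim
      case (elim \<omega>)
      have "?u \<omega> = L *v (?x k \<omega> - expectation (?x k)) + Lm *v expectation (?x k)"
        by (simp add: feedback_def matrix_vector_mult_diff_distrib matrix_vector_mult_diff_rdistrib)
      then have "?u \<omega> = 0"
        using elim(2) out(2)[of k] by simp
      then show ?case
        using elim(1) by (simp add: mf_step_def Eu Ex Let_def)
    qed
  qed simp
  have "zero_vec M (observed M w A Ab C Cb (psd_sqrt (block_diag Q (Q + Qb))) (\<xi> z) k)" for k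
  proof -
    have v: "sqint M (?v k)"
    proof -
      have "integrable M (\<lambda>\<omega>. ?v k \<omega> \<bullet> ?v k \<omega>) = integrable M (\<lambda>\<omega>. ?x k \<omega> \<bullet> ?x k \<omega>)"
        using eq[of k] x[of k] meas[of k]
        by (intro integrable_cong_AE) (auto simp: sqint_def elim: eventually_mono)
      then show ?thesis
        using x[of k] meas[of k] by (simp add: sqint_def)
    qed
    have Ex: "expectation (?v k) = expectation (?x k)"
      by (rule integral_cong_AE[OF meas _ eq]) (use x in \<open>simp add: sqint_def\<close>)
    have "expectation (\<lambda>\<omega>. qf Q (?v k \<omega> - expectation (?v k)) + qf (Q + Qb) (expectation (?v k))) =
        expectation (\<lambda>\<omega>. qf Q (?x k \<omega> - expectation (?x k)) + qf (Q + Qb) (expectation (?x k)))"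
      unfolding Ex using eq[of k] x[of k] meas[of k]
      by (intro integral_cong_AE) (auto simp: sqint_def elim: eventually_mono)
    also have "\<dots> = val (Q, Q + Qb) (?x k)"
      unfolding val_eq_expectation[OF x] qp_def by simp
    finally show ?thesis
      using out(3) unfolding zero_vec_def observed_def Let_def output_energy[OF Q] by simp
  qed
  then have "zero_vec M (\<xi> z)"
    using observable \<xi>(1) unfolding exactly_observable_def by blast
  then have "z \<bullet> z = 0"
    using expectation_norm_val[OF sqint_initial[OF \<xi>(1)], of z]
    unfolding zero_vec_def \<xi>(2) qp_one by simp
  then show ?thesis
    by simp
qed

text \<open>At the test state of \<open>z\<close> the second moment after \<open>k\<close> steps is
  exactly \<open>qp\<close> of the \<open>k\<close>-th iterate.\<close>

lemma stabilizing_imp_cl_op_tendsto: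
  assumes "stabilizing M w A Ab B Bb C Cb D Db (\<lambda>_. L) (\<lambda>_. Lb)"
  shows "(\<lambda>k. qp ((cl_op L (L + Lb) ^^ k) one_pair) z) \<longlonglongrightarrow> 0"
proof -
  obtain \<xi> where \<xi>: "\<And>z :: (real^'n) \<times> (real^'n). initial_state M w (\<xi> z)" "\<And>X z. val X (\<xi> z) = qp X z"
    using test_states_exist by blast
  have "ms_stable M (closed_loop M w A Ab B Bb C Cb D Db (\<lambda>_. L) (\<lambda>_. Lb) (\<xi> z))"
    using assms \<xi>(1) by (simp add: stabilizing_def)
  then show ?thesis
    unfolding ms_stable_def expectation_norm_val[OF state_sqint[OF \<xi>(1)]]
    by (simp add: val_state[OF \<xi>(1)] \<xi>(2))
qed

lemma cl_op_tendsto_imp_stabilizing: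
  assumes "(\<lambda>k. (cl_op L (L + Lb) ^^ k) one_pair) \<longlonglongrightarrow> 0"
  shows "stabilizing M w A Ab B Bb C Cb D Db (\<lambda>_. L) (\<lambda>_. Lb)"
  unfolding stabilizing_def
proof (intro allI impI conjI)
  fix x0 :: "'s \<Rightarrow> real^'n"
  assume x0: "initial_state M w x0"
  show "control M w A Ab B Bb C Cb D Db (\<lambda>_. L) (\<lambda>_. Lb) x0 k \<in> borel_measurable (information M w x0 k)" for k
    by (rule control_information[OF x0])
  show "ms_stable M (closed_loop M w A Ab B Bb C Cb D Db (\<lambda>_. L) (\<lambda>_. Lb) x0)"
    unfolding ms_stable_def expectation_norm_val[OF state_sqint[OF x0]]
    by (simp add: val_state[OF x0]) (rule val_tendsto_0[OF sqint_initial[OF x0] assms])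
qed

section \<open>Fixed points of the Riccati operator\<close>

context
  fixes X assumes X: "psd_pair X" "ric_op X = X"
begin

lemmas fixpoint_lyapunov =
  positive_operator.lyapunov_stability[OF positive_operator_cl_op X(1) ric_op_fixpoint[OF X] psd_cl_cost]

lemma fixpoint_positive: "z \<noteq> 0 \<Longrightarrow> 0 < qp X z"
  by (rule fixpoint_lyapunov(1)) (rule closed_loop_observable)

lemma fixpoint_stable: "(\<lambda>k. (cl_op (gain1 X) (gain2 X) ^^ k) one_pair) \<longlonglongrightarrow> 0"
  by (rule fixpoint_lyapunov(2)) (rule closed_loop_observable)

lemma fixpoint_stabilizing:
  "stabilizing M w A Ab B Bb C Cb D Db (\<lambda>_. gain1 X) (\<lambda>_. gain2 X - gain1 X)"
  by (rule cl_op_tendsto_imp_stabilizing) (simp add: fixpoint_stable)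

section \<open>Optimality of the fixed-point controller\<close>

context
  fixes x0 :: "'s \<Rightarrow> real^'n"
  assumes x0: "initial_state M w x0"
begin

text \<open>This removes the terminal value in both telescoping arguments. The gains may depend on
  time, so a squeeze by the second moment replaces iterates of one operator.\<close>

lemma val_state_tendsto_0:
  assumes "stabilizing M w A Ab B Bb C Cb D Db L Lb"
  shows "(\<lambda>k. val X (closed_loop M w A Ab B Bb C Cb D Db L Lb x0 k)) \<longlonglongrightarrow> 0"
proof -
  have lim: "(\<lambda>k. val one_pair (closed_loop M w A Ab B Bb C Cb D Db L Lb x0 k)) \<longlonglongrightarrow> 0"
    unfolding expectation_norm_val[OF state_sqint[OF x0], symmetric]
    using assms x0 unfolding stabilizing_def ms_stable_def by blast
  show ?thesis
  proof (rule tendsto_sandwich[OF _ _ tendsto_const tendsto_mult_right_zero[OF lim]])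
    show "\<forall>\<^sub>F k in sequentially. 0 \<le> val X (closed_loop M w A Ab B Bb C Cb D Db L Lb x0 k)"
      by (intro always_eventually allI val_nonneg state_sqint[OF x0] psd_pairD X(1))
    show "\<forall>\<^sub>F k in sequentially. val X (closed_loop M w A Ab B Bb C Cb D Db L Lb x0 k)
        \<le> pbound X * val one_pair (closed_loop M w A Ab B Bb C Cb D Db L Lb x0 k)"
      unfolding val_scaleR[OF state_sqint[OF x0], symmetric]
      by (intro always_eventually allI val_mono state_sqint[OF x0]) (simp add: qp_scaleR qp_le_pbound)
  qed
qed

text \<open>By minimality of \<open>ric_op\<close>, \<open>val X\<close> drops in each step by at
  most the stage cost, whatever the gain; comparing partial sums covers infinite cost as
  well.\<close>

lemma cost_lower_bound:
  assumes "stabilizing M w A Ab B Bb C Cb D Db L Lb"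
  shows "ereal (val X x0) \<le> cost M w A Ab B Bb C Cb D Db Q Qb R Rb L Lb x0"
proof -
  let ?x = "closed_loop M w A Ab B Bb C Cb D Db L Lb x0"
  let ?c = "\<lambda>k. val (cl_cost (L k) (L k + Lb k)) (?x k)"
  note sq = state_sqint[OF x0]
  have step: "val X (?x k) \<le> ?c k + val X (?x (Suc k))" for k
  proof -
    have "val X (?x k) \<le> val (cl_cost (L k) (L k + Lb k) + cl_op (L k) (L k + Lb k) X) (?x k)"
      using ric_op_le[OF X(1)] X(2) by (intro val_mono sq) simp
    then show ?thesis
      by (simp only: val_add[OF sq] val_state_Suc[OF x0 psd_pair_sym[OF X(1)]])
  qed
  have telescope: "val X x0 - val X (?x N) \<le> (\<Sum>k<N. ?c k)" for N
  proof (induction N)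
    case (Suc N)
    then show ?case
      using step[of N] by (simp only: sum.lessThan_Suc)
  qed simp
  have nonneg: "0 \<le> ?c k" for k
    by (intro val_nonneg sq psd_pairD psd_cl_cost)
  have "ereal (val X x0 - val X (?x N)) \<le> (\<Sum>k. ereal (?c k))" for N
  proof -
    have "ereal (val X x0 - val X (?x N)) \<le> (\<Sum>k<N. ereal (?c k))"
      using telescope[of N] by simp
    also have "\<dots> \<le> (\<Sum>k. ereal (?c k))"
      by (rule suminf_upper) (simp add: nonneg)
    finally show ?thesis .
  qed
  moreover have "(\<lambda>N. ereal (val X x0 - val X (?x N))) \<longlonglongrightarrow> ereal (val X x0 - 0)"
    by (intro tendsto_ereal tendsto_diff tendsto_const val_state_tendsto_0 assms)
  ultimately show ?thesis
    unfolding cost_eq[OF x0] using LIMSEQ_le_const2 by fastforce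
qed

text \<open>For the gains of \<open>X\<close> itself the Bellman inequality is an equality, so the
  series telescopes exactly.\<close>

lemma fixpoint_cost:
  "cost M w A Ab B Bb C Cb D Db Q Qb R Rb (\<lambda>_. gain1 X) (\<lambda>_. gain2 X - gain1 X) x0 = ereal (val X x0)"
proof -
  let ?x = "closed_loop M w A Ab B Bb C Cb D Db (\<lambda>_. gain1 X) (\<lambda>_. gain2 X - gain1 X) x0"
  let ?c = "\<lambda>k. val (cl_cost (gain1 X) (gain2 X)) (?x k)"
  note sq = state_sqint[OF x0]
  have step: "?c k = val X (?x k) - val X (?x (Suc k))" for k
  proof -
    have "val X (?x (Suc k)) = val (cl_op (gain1 X) (gain2 X) X) (?x k)"
      using val_state_Suc[OF x0 psd_pair_sym[OF X(1)]] by (simp del: closed_loop.simps)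
    moreover have "val X (?x k) = ?c k + val (cl_op (gain1 X) (gain2 X) X) (?x k)"
      using arg_cong[OF ric_op_fixpoint[OF X], of "\<lambda>Y. val Y (?x k)"] by (simp only: val_add[OF sq])
    ultimately show ?thesis
      by linarith
  qed
  have "(\<lambda>k. val X (?x k) - val X (?x (Suc k))) sums (val X (?x 0) - 0)"
    by (intro telescope_sums' val_state_tendsto_0 fixpoint_stabilizing)
  then have "(\<lambda>k. ereal (?c k)) sums ereal (val X x0)"
    by (simp add: step[symmetric] sums_ereal del: closed_loop.simps(2))
  then show ?thesis
    unfolding cost_eq[OF x0] by (simp add: sums_iff)
qed

end

end

text \<open>The value of \<open>X\<close> bounds the cost of the controller of \<open>Y\<close>,
  which is stabilizing and costs exactly the value of \<open>Y\<close>; exchange the roles.\<close>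

lemma fixpoint_unique:
  assumes "psd_pair X" "ric_op X = X" "psd_pair Y" "ric_op Y = Y"
  shows "X = Y"
proof -
  have le: "qp X z \<le> qp Y z" if "psd_pair X" "ric_op X = X" "psd_pair Y" "ric_op Y = Y" for X Y z
  proof -
    obtain \<xi> where \<xi>: "\<And>z :: (real^'n) \<times> (real^'n). initial_state M w (\<xi> z)" "\<And>X z. val X (\<xi> z) = qp X z"
      using test_states_exist by blast
    show ?thesis
      using cost_lower_bound[OF that(1,2) \<xi>(1) fixpoint_stabilizing[OF that(3,4)], of z]
      unfolding fixpoint_cost[OF that(3,4) \<xi>(1)] by (simp add: \<xi>(2))
  qed
  have "qp X z = qp Y z" for z
    by (intro antisym le assms)
  then have "(\<lambda>_::nat. X) \<longlonglongrightarrow> Y"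
    using assms by (intro tendsto_sym_pairI) (auto simp: psd_pair_def)
  then show ?thesis
    using LIMSEQ_unique tendsto_const by blast
qed

text \<open>Adding the first equation to the second cancels the \<open>Z1\<close> terms and collects
  the rest into forms in \<open>A + Ab\<close>, \<open>C + Cb\<close> and
  \<open>P + Pb\<close>.\<close>

lemma riccati_iff:
  "riccati A Ab B Bb C Cb D Db Q Qb R Rb \<sigma> P Pb \<longleftrightarrow> ric_op (P, P + Pb) = (P, P + Pb)"
proof -
  define Z1 where "Z1 = transpose (M1 A B C D \<sigma> P) ** matrix_inv (Upsilon1 B D R \<sigma> P) ** M1 A B C D \<sigma> P"
  define Z2 where "Z2 = transpose (M2 A Ab B Bb C Cb D Db \<sigma> P Pb) ** matrix_inv (Upsilon2 B Bb D Db R Rb \<sigma> P Pb)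
      ** M2 A Ab B Bb C Cb D Db \<sigma> P Pb"
  define W1 where "W1 = Q + transpose A ** P ** A + \<sigma>\<^sup>2 *\<^sub>R (transpose C ** P ** C) - Z1"
  define W2 where "W2 = Qb + transpose A ** P ** Ab + \<sigma>\<^sup>2 *\<^sub>R (transpose C ** P ** Cb)
             + transpose Ab ** P ** A + \<sigma>\<^sup>2 *\<^sub>R (transpose Cb ** P ** C)
             + transpose Ab ** P ** Ab + \<sigma>\<^sup>2 *\<^sub>R (transpose Cb ** P ** Cb)
             + transpose (A + Ab) ** Pb ** (A + Ab) + Z1 - Z2"
  have "riccati A Ab B Bb C Cb D Db Q Qb R Rb \<sigma> P Pb \<longleftrightarrow> P = W1 \<and> Pb = W2"
    by (simp add: riccati_def Let_def W1_def W2_def Z1_def Z2_def)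
  then have "riccati A Ab B Bb C Cb D Db Q Qb R Rb \<sigma> P Pb \<longleftrightarrow> W1 = P \<and> W1 + W2 = P + Pb"
    by (metis add_left_cancel)
  moreover have "W1 = fst (ric_op (P, P + Pb))"
    by (simp add: W1_def Z1_def ric_op_def ric_def cross_def ups_def M1_def Upsilon1_def)
  moreover have "W1 + W2 = snd (ric_op (P, P + Pb))"
  proof -
    have "W1 + W2 = Q + Qb + transpose (A + Ab) ** (P + Pb) ** (A + Ab)
        + \<sigma>\<^sup>2 *\<^sub>R (transpose (C + Cb) ** P ** (C + Cb)) - Z2"
      by (simp add: W1_def W2_def transpose_add matrix_add_ldistrib matrix_add_rdistrib_mult scaleR_add_right)
    then show ?thesis
      by (simp add: Z2_def ric_op_def ric_def cross_def ups_def M2_def Upsilon2_def)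
  qed
  ultimately show ?thesis
    by (simp only: prod_eq_iff fst_conv snd_conv)
qed

text \<open>Observability upgrades a semidefinite fixed point to a definite one through
  \<open>fixpoint_positive\<close>, so value iteration from 0 does yield a solution.\<close>

lemma riccati_solution_iff:
  "riccati_solution A Ab B Bb C Cb D Db Q Qb R Rb \<sigma> (P, Pb) \<longleftrightarrow>
    psd_pair (P, P + Pb) \<and> ric_op (P, P + Pb) = (P, P + Pb)"
  (is "?lhs \<longleftrightarrow> ?rhs")
proof
  assume ?lhs
  then show ?rhs
    by (simp add: riccati_solution_def riccati_iff psd_pair_iff pos_def_imp_semidef)
next
  assume rhs: ?rhs
  then have sym: "transpose P = P" "transpose (P + Pb) = P + Pb"
    by (auto simp: psd_pair_def sym_pair_def)
  have "pos_def P" "pos_def (P + Pb)"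
    unfolding pos_def_iff
    using sym fixpoint_positive[of "(P, P + Pb)" "(_, 0)"] fixpoint_positive[of "(P, P + Pb)" "(0, _)"] rhs
    by (auto simp: zero_prod_def)
  then show ?lhs
    using rhs sym by (simp add: riccati_solution_def riccati_iff transpose_add)
qed

lemma gains_eq:
  "gain_K A B C D R \<sigma> P = gain1 (P, P + Pb)"
  "gain_Kb A Ab B Bb C Cb D Db R Rb \<sigma> P Pb = gain2 (P, P + Pb) - gain1 (P, P + Pb)"
  by (simp_all add: gain_K_def gain_Kb_def gain1_def gain2_def gain_def cross_def ups_def
      M1_def M2_def Upsilon1_def Upsilon2_def)

lemma stabilizable_iff:
  "stabilizable M w A Ab B Bb C Cb D Db \<longleftrightarrow> (\<exists>!PPb. riccati_solution A Ab B Bb C Cb D Db Q Qb R Rb \<sigma> PPb)"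
proof
  assume "stabilizable M w A Ab B Bb C Cb D Db"
  then obtain L Lb where "stabilizing M w A Ab B Bb C Cb D Db (\<lambda>_. L) (\<lambda>_. Lb)"
    by (auto simp: stabilizable_def)
  from riccati_exists[OF stabilizing_imp_cl_op_tendsto[OF this]]
  obtain X where X: "psd_pair X" "ric_op X = X" .
  show "\<exists>!PPb. riccati_solution A Ab B Bb C Cb D Db Q Qb R Rb \<sigma> PPb"
  proof (rule ex1I)
    show "riccati_solution A Ab B Bb C Cb D Db Q Qb R Rb \<sigma> (fst X, snd X - fst X)"
      using X by (simp add: riccati_solution_iff)
    fix PPb
    assume PPb: "riccati_solution A Ab B Bb C Cb D Db Q Qb R Rb \<sigma> PPb"
    obtain P Pb where "PPb = (P, Pb)"
      by (cases PPb)
    have "(P, P + Pb) = X"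
      using PPb unfolding \<open>PPb = (P, Pb)\<close> riccati_solution_iff by (metis fixpoint_unique X)
    from this[symmetric] show "PPb = (fst X, snd X - fst X)"
      by (simp add: \<open>PPb = (P, Pb)\<close>)
  qed
next
  assume "\<exists>!PPb. riccati_solution A Ab B Bb C Cb D Db Q Qb R Rb \<sigma> PPb"
  then obtain P Pb where "riccati_solution A Ab B Bb C Cb D Db Q Qb R Rb \<sigma> (P, Pb)"
    by auto
  then show "stabilizable M w A Ab B Bb C Cb D Db"
    unfolding stabilizable_def riccati_solution_iff using fixpoint_stabilizing by blast
qed

end

theorem theorem4:
  fixes M :: "'s measure" and w :: "nat \<Rightarrow> 's \<Rightarrow> real" and \<sigma> :: real
    and A Ab C Cb Q Qb :: "real^'n^'n"
    and B Bb D Db :: "real^'m^'n"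
    and R Rb :: "real^'m^'m"
  assumes noise: "white_noise M w \<sigma>"
    and random_initial: "\<exists>x0 :: 's \<Rightarrow> real^'n. initial_state M w x0 \<and>
          \<not> zero_vec M (\<lambda>\<omega>. x0 \<omega> - prob_space.expectation M x0)"
    and symmetric: "transpose Q = Q" "transpose Qb = Qb" "transpose R = R" "transpose Rb = Rb"
    and R_pos: "pos_def R" "pos_def (R + Rb)"
    and Q_nonneg: "pos_semidef Q" "pos_semidef (Q + Qb)"
    and observable: "exactly_observable M w A Ab C Cb (psd_sqrt (block_diag Q (Q + Qb)))"
  shows "(stabilizable M w A Ab B Bb C Cb D Db \<longleftrightarrow>
            (\<exists>!PPb. riccati_solution A Ab B Bb C Cb D Db Q Qb R Rb \<sigma> PPb)) \<and>
         (\<forall>P Pb K Kb.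
            riccati_solution A Ab B Bb C Cb D Db Q Qb R Rb \<sigma> (P, Pb) \<longrightarrow>
            K = gain_K A B C D R \<sigma> P \<longrightarrow>
            Kb = gain_Kb A Ab B Bb C Cb D Db R Rb \<sigma> P Pb \<longrightarrow>
            stabilizing M w A Ab B Bb C Cb D Db (\<lambda>_. K) (\<lambda>_. Kb) \<and>
            (\<forall>x0. initial_state M w x0 \<longrightarrow>
               (\<forall>L Lb. stabilizing M w A Ab B Bb C Cb D Db L Lb \<longrightarrow>
                  cost M w A Ab B Bb C Cb D Db Q Qb R Rb (\<lambda>_. K) (\<lambda>_. Kb) x0
                    \<le> cost M w A Ab B Bb C Cb D Db Q Qb R Rb L Lb x0) \<and>
               cost M w A Ab B Bb C Cb D Db Q Qb R Rb (\<lambda>_. K) (\<lambda>_. Kb) x0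
                 = ereal (prob_space.expectation M (\<lambda>\<omega>. x0 \<omega> \<bullet> (P *v x0 \<omega>))
                     + prob_space.expectation M x0 \<bullet> (Pb *v prob_space.expectation M x0))))"
proof -
  interpret prob_space M
    using noise by (simp add: white_noise_def)
  interpret observable_mean_field A Ab C Cb Q Qb B Bb D Db R Rb \<sigma> M w
    by unfold_locales (use assms in auto)
  have solution: "stabilizing M w A Ab B Bb C Cb D Db (\<lambda>_. K) (\<lambda>_. Kb) \<and>
      (\<forall>x0. initial_state M w x0 \<longrightarrow>
         (\<forall>L Lb. stabilizing M w A Ab B Bb C Cb D Db L Lb \<longrightarrow>
            cost M w A Ab B Bb C Cb D Db Q Qb R Rb (\<lambda>_. K) (\<lambda>_. Kb) x0
              \<le> cost M w A Ab B Bb C Cb D Db Q Qb R Rb L Lb x0) \<and>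
         cost M w A Ab B Bb C Cb D Db Q Qb R Rb (\<lambda>_. K) (\<lambda>_. Kb) x0
           = ereal (expectation (\<lambda>\<omega>. x0 \<omega> \<bullet> (P *v x0 \<omega>)) + expectation x0 \<bullet> (Pb *v expectation x0)))"
    if sol: "riccati_solution A Ab B Bb C Cb D Db Q Qb R Rb \<sigma> (P, Pb)"
      and K: "K = gain_K A B C D R \<sigma> P" and Kb: "Kb = gain_Kb A Ab B Bb C Cb D Db R Rb \<sigma> P Pb"
    for P Pb K Kb
  proof -
    from sol have X: "psd_pair (P, P + Pb)" "ric_op (P, P + Pb) = (P, P + Pb)"
      by (simp_all only: riccati_solution_iff)
    have P: "transpose P = P"
      using sol by (simp add: riccati_solution_def)
    have x0_value: "expectation (\<lambda>\<omega>. x0 \<omega> \<bullet> (P *v x0 \<omega>)) + expectation x0 \<bullet> (Pb *v expectation x0)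
        = val (P, P + Pb) x0" if "initial_state M w x0" for x0
      using expectation_qf_pair[OF sqint_initial[OF that] P, of Pb] by (simp only: qf_def)
    show ?thesis
      unfolding K Kb gains_eq(1)[of P Pb] gains_eq(2)
      using fixpoint_stabilizing[OF X] fixpoint_cost[OF X] cost_lower_bound[OF X] x0_value by simp
  qed
  show ?thesis
    using stabilizable_iff solution by blast
qed

end
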